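(* Let $c\in\mathbb R$ with $|c|<1$ and let $\pi_c=(c-x_3)\pi$ be the necklace Poisson structure on $S^2$. Then $\pi_c$ does not admit infinitesimal rescaling; that is, the class of $\pi_c$ in $H^2_{\pi_c}(S^2)$ is nonzero (equivalently, there is no vector field $X$ on $S^2$ with $L_X\pi_c=\pi_c$).
   Context: $S^2\subset\mathbb R^3$ is the unit sphere with coordinates $(x_1,x_2,x_3)$, and $\pi$ is the standard rotation-invariant symplectic Poisson structure: in the stereographic coordinate $w=x+iy$ with $x_3=\frac{1-x^2-y^2}{1+x^2+y^2}$, $\pi=\frac14(1+x^2+y^2)^2\partial_x\wedge\partial_y$ and $\pi_c=(c-x_3)\pi=\frac14(1+x^2+y^2)\big((c+1)(x^2+y^2)+c-1\big)\partial_x\wedge\partial_y$. For $|c|<1$ these are called necklace structures. The Poisson cohomology $H^\star_{\pi_c}(S^2)$ is the cohomology of the complex of smooth multivector fields with differential $d_{\pi_c}=[\pi_c,\cdot]$ (Schouten bracket). *)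

theory Defs
  imports "HOL-Analysis.Analysis" "HOL-Library.Function_Algebras"
begin

section \<open>Smooth functions on the sphere\<close>

typedef S2 = "sphere (0 :: real ^ 3) 1"
  by (rule exI[of _ "axis 1 1"]) (simp add: norm_axis_1)

definition coord :: "3 \<Rightarrow> S2 \<Rightarrow> real" where
  "coord i p = Rep_S2 p $ i"

text \<open>Two parametrisations of the sphere by the plane. The first is inverse to the stereographic
  coordinate \<open>w = x + iy\<close> with \<open>x\<^sub>3 = (1 - x\<^sup>2 - y\<^sup>2) / (1 + x\<^sup>2 + y\<^sup>2)\<close> and misses the south pole.
  The second is the first precomposed with \<open>w \<mapsto> 1 / w\<close> (see \<open>point_S_eq_point_N\<close>), covers the south
  pole at \<open>w = 0\<close>, and defines the same orientation.\<close>

definition point_N :: "complex \<Rightarrow> S2" where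
  "point_N w = Abs_S2 (vector [2 * Re w / (1 + (cmod w)\<^sup>2), 2 * Im w / (1 + (cmod w)\<^sup>2),
                               (1 - (cmod w)\<^sup>2) / (1 + (cmod w)\<^sup>2)])"

definition point_S :: "complex \<Rightarrow> S2" where
  "point_S w = Abs_S2 (vector [2 * Re w / (1 + (cmod w)\<^sup>2), - 2 * Im w / (1 + (cmod w)\<^sup>2),
                               ((cmod w)\<^sup>2 - 1) / (1 + (cmod w)\<^sup>2)])"

definition stereo_N :: "S2 \<Rightarrow> complex" where
  "stereo_N p = Complex (coord 1 p / (1 + coord 3 p)) (coord 2 p / (1 + coord 3 p))"

definition stereo_S :: "S2 \<Rightarrow> complex" where
  "stereo_S p = Complex (coord 1 p / (1 - coord 3 p)) (- coord 2 p / (1 - coord 3 p))"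

primrec times_differentiable :: "nat \<Rightarrow> ('a::real_normed_vector \<Rightarrow> 'b::real_normed_vector) \<Rightarrow> bool"
  where
  "times_differentiable 0 f \<longleftrightarrow> continuous_on UNIV f"
| "times_differentiable (Suc k) f \<longleftrightarrow> (\<forall>x. f differentiable (at x)) \<and>
     (\<forall>v. times_differentiable k (\<lambda>x. frechet_derivative f (at x) v))"

definition smooth_fun :: "('a::real_normed_vector \<Rightarrow> 'b::real_normed_vector) \<Rightarrow> bool" where
  "smooth_fun f \<longleftrightarrow> (\<forall>k. times_differentiable k f)"

definition smooth_S2 :: "(S2 \<Rightarrow> real) set" where
  "smooth_S2 = {f. smooth_fun (f \<circ> point_N) \<and> smooth_fun (f \<circ> point_S)}"

section \<open>Multivector fields\<close>

text \<open>The smooth sections of the \<open>k\<close>-th exterior power of the tangent bundle are represented by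
  their evaluations \<open>(f\<^sub>1, \<dots>, f\<^sub>k) \<mapsto> P(df\<^sub>1, \<dots>, df\<^sub>k)\<close>: alternating \<open>k\<close>-linear maps on smooth
  functions that are derivations in each argument (for \<open>k = 0\<close>, smooth functions; for \<open>k = 1\<close>,
  derivations). Arguments are lists, and a field takes the value \<open>0\<close> on lists that are not
  \<open>k\<close>-tuples of smooth functions, so that equality of fields is equality in HOL.\<close>

type_synonym multivector = "(S2 \<Rightarrow> real) list \<Rightarrow> S2 \<Rightarrow> real"

definition smooth_tuples :: "nat \<Rightarrow> (S2 \<Rightarrow> real) list set" where
  "smooth_tuples k = {fs. length fs = k \<and> set fs \<subseteq> smooth_S2}"

definition multivector_fields :: "nat \<Rightarrow> multivector set" where
  "multivector_fields k = {P.
     (\<forall>fs. fs \<notin> smooth_tuples k \<longrightarrow> P fs = 0) \<and>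
     (\<forall>fs \<in> smooth_tuples k. P fs \<in> smooth_S2) \<and>
     (\<forall>fs \<in> smooth_tuples k. \<forall>i<k. \<forall>f \<in> smooth_S2. \<forall>g \<in> smooth_S2. \<forall>a b :: real.
        P (fs[i := (\<lambda>p. a * f p + b * g p)]) =
          (\<lambda>p. a * P (fs[i := f]) p + b * P (fs[i := g]) p)) \<and>
     (\<forall>fs \<in> smooth_tuples k. \<forall>i<k. \<forall>f \<in> smooth_S2. \<forall>g \<in> smooth_S2.
        P (fs[i := f * g]) = f * P (fs[i := g]) + g * P (fs[i := f])) \<and>
     (\<forall>fs \<in> smooth_tuples k. \<forall>i<k. \<forall>j<k. i \<noteq> j \<longrightarrow>
        P (fs[i := fs ! j, j := fs ! i]) = - P fs)}"

section \<open>Schouten bracket and Poisson cohomology\<close>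

text \<open>The brackets are those of multiderivations: \<open>insertion p q P Q\<close> is the signed sum over
  shuffles of \<open>P(Q(f\<^sub>A), f\<^sub>B)\<close>, where \<open>B\<close> is the complement of \<open>A\<close>, and the Schouten bracket is its
  graded commutator. In degree \<open>(2, 1)\<close> it is \<open>- L\<^sub>X \<pi>\<close>, see \<open>poisson_diff_vector_field\<close>.\<close>

text \<open>Sign of the permutation listing first \<open>A\<close> and then its complement, both in increasing order.\<close>

definition shuffle_sign :: "nat set \<Rightarrow> real" where
  "shuffle_sign A = (- 1) ^ card {(i, j). i \<in> A \<and> j \<notin> A \<and> j < i}"

definition insertion :: "nat \<Rightarrow> nat \<Rightarrow> multivector \<Rightarrow> multivector \<Rightarrow> multivector" where
  "insertion p q P Q fs =
     (\<lambda>x. \<Sum>A | A \<subseteq> {..<p + q - 1} \<and> card A = q.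
        shuffle_sign A * P (Q (nths fs A) # nths fs (- A)) x)"

text \<open>The Schouten bracket of a \<open>p\<close>-vector and a \<open>q\<close>-vector field. The exponent
  \<open>(p + 1) * (q + 1)\<close> has the parity of the usual \<open>(p - 1) * (q - 1)\<close> but avoids
  truncated subtraction.\<close>

definition schouten :: "nat \<Rightarrow> nat \<Rightarrow> multivector \<Rightarrow> multivector \<Rightarrow> multivector" where
  "schouten p q P Q fs =
     (if fs \<in> smooth_tuples (p + q - 1)
      then (\<lambda>x. insertion p q P Q fs x - (- 1) ^ ((p + 1) * (q + 1)) * insertion q p Q P fs x)
      else 0)"

definition poisson_diff :: "multivector \<Rightarrow> nat \<Rightarrow> multivector \<Rightarrow> multivector" where
  "poisson_diff \<pi> k P = schouten 2 k \<pi> P"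

definition cocycles :: "multivector \<Rightarrow> nat \<Rightarrow> multivector set" where
  "cocycles \<pi> k = {P \<in> multivector_fields k. poisson_diff \<pi> k P = 0}"

definition coboundaries :: "multivector \<Rightarrow> nat \<Rightarrow> multivector set" where
  "coboundaries \<pi> k =
     (case k of 0 \<Rightarrow> {0} | Suc j \<Rightarrow> poisson_diff \<pi> j ` multivector_fields j)"

definition cohomologous :: "multivector \<Rightarrow> nat \<Rightarrow> (multivector \<times> multivector) set" where
  "cohomologous \<pi> k =
     {(P, Q). P \<in> cocycles \<pi> k \<and> Q \<in> cocycles \<pi> k \<and> Q - P \<in> coboundaries \<pi> k}"

definition poisson_cohomology :: "multivector \<Rightarrow> nat \<Rightarrow> multivector set set" where
  "poisson_cohomology \<pi> k = cocycles \<pi> k // cohomologous \<pi> k"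

definition cohomology_class :: "multivector \<Rightarrow> nat \<Rightarrow> multivector \<Rightarrow> multivector set" where
  "cohomology_class \<pi> k P = cohomologous \<pi> k `` {P}"

definition lie_derivative :: "nat \<Rightarrow> multivector \<Rightarrow> multivector \<Rightarrow> multivector" where
  "lie_derivative k X P fs =
     (if fs \<in> smooth_tuples k then X [P fs] - (\<Sum>i<k. P (fs[i := X [fs ! i]])) else 0)"

section \<open>The necklace structures\<close>

text \<open>The value at \<open>w\<close> of \<open>((1 + x\<^sup>2 + y\<^sup>2)\<^sup>2 / 4) \<partial>\<^sub>x \<and> \<partial>\<^sub>y\<close> on two functions of \<open>w = x + iy\<close>.\<close>

definition chart_bracket :: "(complex \<Rightarrow> real) \<Rightarrow> (complex \<Rightarrow> real) \<Rightarrow> complex \<Rightarrow> real" where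
  "chart_bracket f g w = 1 / 4 * (1 + (Re w)\<^sup>2 + (Im w)\<^sup>2)\<^sup>2 *
     (frechet_derivative f (at w) 1 * frechet_derivative g (at w) \<i> -
      frechet_derivative f (at w) \<i> * frechet_derivative g (at w) 1)"

text \<open>The bivector \<open>\<pi>\<close> has the same expression in both charts, cf. \<open>standard_bracket_point_S\<close>
  below; the second chart only serves to cover the south pole.\<close>

definition standard_bracket :: "(S2 \<Rightarrow> real) \<Rightarrow> (S2 \<Rightarrow> real) \<Rightarrow> S2 \<Rightarrow> real" where
  "standard_bracket f g p =
     (if coord 3 p \<noteq> - 1 then chart_bracket (f \<circ> point_N) (g \<circ> point_N) (stereo_N p)
      else chart_bracket (f \<circ> point_S) (g \<circ> point_S) (stereo_S p))"

definition necklace :: "real \<Rightarrow> multivector" where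
  "necklace c fs =
     (if fs \<in> smooth_tuples 2
      then (\<lambda>p. (c - coord 3 p) * standard_bracket (fs ! 0) (fs ! 1) p) else 0)"

section \<open>Consistency with the usual formulas\<close>

lemma denom_pos: "1 + (cmod w)\<^sup>2 > 0"
  by (smt (verit) zero_le_power2)

lemma Rep_point_N:
  "Rep_S2 (point_N w) = vector [2 * Re w / (1 + (cmod w)\<^sup>2), 2 * Im w / (1 + (cmod w)\<^sup>2),
                               (1 - (cmod w)\<^sup>2) / (1 + (cmod w)\<^sup>2)]"
proof -
  have "(1 + (cmod w)\<^sup>2) \<noteq> 0" using denom_pos[of w] by simp
  moreover have "(2 * Re w)\<^sup>2 + (2 * Im w)\<^sup>2 + (1 - (cmod w)\<^sup>2)\<^sup>2 = (1 + (cmod w)\<^sup>2)\<^sup>2"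
    unfolding cmod_power2 by algebra
  ultimately show ?thesis
    unfolding point_N_def
    by (intro Abs_S2_inverse)
       (simp add: norm_vec_def L2_set_def sum_3 power_divide add_divide_distrib[symmetric])
qed

lemma Rep_point_S:
  "Rep_S2 (point_S w) = vector [2 * Re w / (1 + (cmod w)\<^sup>2), - 2 * Im w / (1 + (cmod w)\<^sup>2),
                               ((cmod w)\<^sup>2 - 1) / (1 + (cmod w)\<^sup>2)]"
proof -
  have "(1 + (cmod w)\<^sup>2) \<noteq> 0" using denom_pos[of w] by simp
  moreover have "(2 * Re w)\<^sup>2 + (2 * Im w)\<^sup>2 + ((cmod w)\<^sup>2 - 1)\<^sup>2 = (1 + (cmod w)\<^sup>2)\<^sup>2"
    unfolding cmod_power2 by algebra
  ultimately show ?thesis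
    unfolding point_S_def
    by (intro Abs_S2_inverse)
       (simp add: norm_vec_def L2_set_def sum_3 power_divide add_divide_distrib[symmetric])
qed

lemma coord_point_N:
  "coord 1 (point_N w) = 2 * Re w / (1 + (cmod w)\<^sup>2)"
  "coord 2 (point_N w) = 2 * Im w / (1 + (cmod w)\<^sup>2)"
  "coord 3 (point_N w) = (1 - (cmod w)\<^sup>2) / (1 + (cmod w)\<^sup>2)"
  by (simp_all add: coord_def Rep_point_N)

lemma coord_point_S:
  "coord 1 (point_S w) = 2 * Re w / (1 + (cmod w)\<^sup>2)"
  "coord 2 (point_S w) = - 2 * Im w / (1 + (cmod w)\<^sup>2)"
  "coord 3 (point_S w) = ((cmod w)\<^sup>2 - 1) / (1 + (cmod w)\<^sup>2)"
  by (simp_all add: coord_def Rep_point_S)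

lemma coord3_point_N: "1 + coord 3 (point_N w) = 2 / (1 + (cmod w)\<^sup>2)"
  using denom_pos[of w] by (simp add: coord_point_N field_simps)

lemma coord3_point_S: "1 - coord 3 (point_S w) = 2 / (1 + (cmod w)\<^sup>2)"
  using denom_pos[of w] by (simp add: coord_point_S field_simps)

lemma stereo_N_point_N: "stereo_N (point_N w) = w"
  using denom_pos[of w]
  by (simp add: stereo_N_def coord3_point_N) (simp add: coord_point_N complex_eq_iff)

lemma stereo_S_point_S: "stereo_S (point_S w) = w"
  using denom_pos[of w]
  by (simp add: stereo_S_def coord3_point_S) (simp add: coord_point_S complex_eq_iff)

lemma S2_coords_eqI:
  assumes "\<And>i. coord i p = coord i q"
  shows "p = q"
  using assms by (simp add: coord_def Rep_S2_inject[symmetric] vec_eq_iff)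

lemma point_S_eq_point_N:
  assumes "w \<noteq> 0"
  shows "point_S w = point_N (inverse w)"
proof (rule S2_coords_eqI)
  fix i :: 3
  have n: "(cmod w)\<^sup>2 \<noteq> 0" using assms by simp
  have c: "(cmod (inverse w))\<^sup>2 = inverse ((cmod w)\<^sup>2)"
    by (simp add: norm_inverse power_inverse)
  have ri: "Re (inverse w) = Re w / (cmod w)\<^sup>2" "Im (inverse w) = - Im w / (cmod w)\<^sup>2"
    by (simp_all add: cmod_power2)
  have d: "1 + inverse ((cmod w)\<^sup>2) = (1 + (cmod w)\<^sup>2) / (cmod w)\<^sup>2"
    using n by (simp add: field_simps)
  have e: "1 - inverse ((cmod w)\<^sup>2) = ((cmod w)\<^sup>2 - 1) / (cmod w)\<^sup>2"
    using n by (simp add: field_simps)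
  consider "i = 1" | "i = 2" | "i = 3" using exhaust_3 by blast
  then show "coord i (point_S w) = coord i (point_N (inverse w))"
    by cases (use n assms in \<open>simp_all only: coord_point_N coord_point_S c ri d e, simp_all\<close>)
qed

lemma standard_bracket_point_N:
  "standard_bracket f g (point_N w) = chart_bracket (f \<circ> point_N) (g \<circ> point_N) w"
proof -
  have "coord 3 (point_N w) \<noteq> - 1"
    using coord3_point_N[of w] denom_pos[of w]
    by (metis add.right_inverse divide_pos_pos less_irrefl zero_less_numeral)
  then show ?thesis by (simp add: standard_bracket_def stereo_N_point_N)
qed

lemma standard_bracket_point_S:
  assumes "f \<in> smooth_S2" and "g \<in> smooth_S2"
  shows "standard_bracket f g (point_S w) = chart_bracket (f \<circ> point_S) (g \<circ> point_S) w"
proof (cases "w = 0")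
  case True
  then show ?thesis by (simp add: standard_bracket_def stereo_S_point_S coord_point_S)
next
  case False
  define v where "v = - inverse w * inverse w"
  have chain: "frechet_derivative (h \<circ> point_S) (at w) u =
      frechet_derivative (h \<circ> point_N) (at (inverse w)) (u * v)" if "h \<in> smooth_S2" for h u
  proof -
    have "times_differentiable (Suc 0) (h \<circ> point_N)"
      using that unfolding smooth_S2_def smooth_fun_def by blast
    then have "((h \<circ> point_N) has_derivative frechet_derivative (h \<circ> point_N) (at (inverse w)))
        (at (inverse w))"
      by (simp add: frechet_derivative_works)
    moreover have "(inverse has_derivative (\<lambda>u. u * v)) (at w)"
      using has_derivative_inverse'[OF False, of UNIV]
      by (simp add: v_def mult_ac)
    ultimately have
      "((h \<circ> point_N) \<circ> inverse has_derivative
         frechet_derivative (h \<circ> point_N) (at (inverse w)) \<circ> (\<lambda>u. u * v)) (at w)"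
      by (intro diff_chain_at)
    then have "(h \<circ> point_S has_derivative
         frechet_derivative (h \<circ> point_N) (at (inverse w)) \<circ> (\<lambda>u. u * v)) (at w)"
      by (rule has_derivative_transform_within_open[of _ _ _ _ "- {0}"])
         (use False in \<open>auto simp: point_S_eq_point_N\<close>)
    from frechet_derivative_at[OF this, symmetric] show ?thesis by simp
  qed
  have lin: "frechet_derivative (h \<circ> point_N) (at (inverse w)) z =
      Re z * frechet_derivative (h \<circ> point_N) (at (inverse w)) 1 +
      Im z * frechet_derivative (h \<circ> point_N) (at (inverse w)) \<i>" if "h \<in> smooth_S2" for h z
  proof -
    have "times_differentiable (Suc 0) (h \<circ> point_N)"
      using that unfolding smooth_S2_def smooth_fun_def by blast
    then have L: "linear (frechet_derivative (h \<circ> point_N) (at (inverse w)))"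
      by (simp add: linear_frechet_derivative)
    have "z = Re z *\<^sub>R 1 + Im z *\<^sub>R \<i>" by (simp add: complex_eq_iff)
    then have "frechet_derivative (h \<circ> point_N) (at (inverse w)) z =
        frechet_derivative (h \<circ> point_N) (at (inverse w)) (Re z *\<^sub>R 1 + Im z *\<^sub>R \<i>)"
      by (rule arg_cong)
    then show ?thesis
      by (simp only: linear_add[OF L] linear_scale[OF L] real_scaleR_def)
  qed
  have n: "(cmod w)\<^sup>2 \<noteq> 0" using False by simp
  have "(Re v)\<^sup>2 + (Im v)\<^sup>2 = (cmod v)\<^sup>2" by (simp add: cmod_power2)
  also have "\<dots> = inverse ((cmod w)\<^sup>2) ^ 2"
    by (simp add: v_def norm_mult norm_inverse power2_eq_square)
  finally have det: "(Re v)\<^sup>2 + (Im v)\<^sup>2 = inverse ((cmod w)\<^sup>2) ^ 2" .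
  have fac: "(1 + (cmod w)\<^sup>2)\<^sup>2 * inverse ((cmod w)\<^sup>2) ^ 2 = (1 + (cmod (inverse w))\<^sup>2)\<^sup>2"
  proof -
    have "(1 + (cmod w)\<^sup>2) * inverse ((cmod w)\<^sup>2) = 1 + (cmod (inverse w))\<^sup>2"
      unfolding norm_inverse power_inverse distrib_right right_inverse[OF n] by simp
    then show ?thesis by (simp only: power_mult_distrib[symmetric])
  qed
  define a b c d where "a = frechet_derivative (f \<circ> point_N) (at (inverse w)) 1"
    and "b = frechet_derivative (f \<circ> point_N) (at (inverse w)) \<i>"
    and "c = frechet_derivative (g \<circ> point_N) (at (inverse w)) 1"
    and "d = frechet_derivative (g \<circ> point_N) (at (inverse w)) \<i>"
  have "frechet_derivative (f \<circ> point_S) (at w) 1 = Re v * a + Im v * b"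
    using chain[OF assms(1), of 1] lin[OF assms(1), of v] by (simp only: mult_1 a_def b_def)
  moreover have "frechet_derivative (g \<circ> point_S) (at w) 1 = Re v * c + Im v * d"
    using chain[OF assms(2), of 1] lin[OF assms(2), of v] by (simp only: mult_1 c_def d_def)
  moreover have "frechet_derivative (f \<circ> point_S) (at w) \<i> = - Im v * a + Re v * b"
    using chain[OF assms(1), of \<i>] lin[OF assms(1), of "\<i> * v"]
    by (simp only: Re_i_times Im_i_times a_def b_def)
  moreover have "frechet_derivative (g \<circ> point_S) (at w) \<i> = - Im v * c + Re v * d"
    using chain[OF assms(2), of \<i>] lin[OF assms(2), of "\<i> * v"]
    by (simp only: Re_i_times Im_i_times c_def d_def)
  ultimately have "chart_bracket (f \<circ> point_S) (g \<circ> point_S) w = 1 / 4 * (1 + (cmod w)\<^sup>2)\<^sup>2 *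
      ((Re v * a + Im v * b) * (- Im v * c + Re v * d) -
       (- Im v * a + Re v * b) * (Re v * c + Im v * d))"
    by (simp only: chart_bracket_def cmod_power2 add.assoc)
  also have "\<dots> = 1 / 4 * ((1 + (cmod w)\<^sup>2)\<^sup>2 * ((Re v)\<^sup>2 + (Im v)\<^sup>2)) * (a * d - b * c)"
  proof -
    have "(Re v * a + Im v * b) * (- Im v * c + Re v * d) -
        (- Im v * a + Re v * b) * (Re v * c + Im v * d) =
        ((Re v)\<^sup>2 + (Im v)\<^sup>2) * (a * d - b * c)"
      by algebra
    then show ?thesis by (simp only: mult.assoc)
  qed
  also have "\<dots> = chart_bracket (f \<circ> point_N) (g \<circ> point_N) (inverse w)"
    unfolding det fac by (simp only: chart_bracket_def a_def b_def c_def d_def cmod_power2 add.assoc)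
  finally show ?thesis
    by (simp add: point_S_eq_point_N[OF False] standard_bracket_point_N)
qed

lemma necklace_point_N:
  assumes "f \<in> smooth_S2" and "g \<in> smooth_S2"
  shows "necklace c [f, g] (point_N w) =
    1 / 4 * (1 + (Re w)\<^sup>2 + (Im w)\<^sup>2) * ((c + 1) * ((Re w)\<^sup>2 + (Im w)\<^sup>2) + c - 1) *
    (frechet_derivative (f \<circ> point_N) (at w) 1 * frechet_derivative (g \<circ> point_N) (at w) \<i> -
     frechet_derivative (f \<circ> point_N) (at w) \<i> * frechet_derivative (g \<circ> point_N) (at w) 1)"
proof -
  have *: "c - coord 3 (point_N w) =
      ((c + 1) * ((Re w)\<^sup>2 + (Im w)\<^sup>2) + c - 1) / (1 + (Re w)\<^sup>2 + (Im w)\<^sup>2)"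
    using denom_pos[of w] by (simp add: coord_point_N cmod_power2 field_simps)
  have "1 + (Re w)\<^sup>2 + (Im w)\<^sup>2 \<noteq> 0"
    using denom_pos[of w] by (simp add: cmod_power2)
  then show ?thesis
    using assms
    by (simp add: necklace_def smooth_tuples_def standard_bracket_point_N chart_bracket_def *
        power2_eq_square[of "1 + _ + _"])
qed

lemma poisson_diff_vector_field:
  "poisson_diff \<pi> 1 X = - lie_derivative 2 X \<pi>"
  if "\<pi> \<in> multivector_fields 2" and "X \<in> multivector_fields 1"
proof (rule ext)
  fix fs :: "(S2 \<Rightarrow> real) list"
  show "poisson_diff \<pi> 1 X fs = (- lie_derivative 2 X \<pi>) fs"
  proof (cases "fs \<in> smooth_tuples 2")
    case False
    then show ?thesis by (simp add: poisson_diff_def schouten_def lie_derivative_def)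
  next
    case True
    then obtain f g where fs: "fs = [f, g]" and fg: "f \<in> smooth_S2" "g \<in> smooth_S2"
      by (auto simp: smooth_tuples_def eval_nat_numeral length_Suc_conv)
    have sub: "{A :: nat set. A \<subseteq> {..<2} \<and> card A = 1} = {{0}, {1}}"
      by (auto simp: card_1_singleton_iff less_2_cases_iff)
    have "A = {0, 1}" if "A \<subseteq> {..<2}" "card A = 2" for A :: "nat set"
    proof -
      have "A = {..<2}"
        using card_subset_eq[of "{..<2::nat}" A] that by simp
      also have "\<dots> = {0, 1}" by (auto simp: less_2_cases_iff)
      finally show ?thesis .
    qed
    moreover have "{0, 1::nat} \<subseteq> {..<2}" "card {0, 1::nat} = 2" by simp_all
    ultimately have sub2: "{A :: nat set. A \<subseteq> {..<2} \<and> card A = 2} = {{0, 1}}"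
      by blast
    have e0: "{(i, j). i \<in> {0::nat} \<and> j \<notin> {0} \<and> j < i} = {}" by auto
    have s0: "shuffle_sign {0} = 1" unfolding shuffle_sign_def e0 by simp
    have e1: "{(i, j). i \<in> {1::nat} \<and> j \<notin> {1} \<and> j < i} = {(1, 0)}" by auto
    have s1: "shuffle_sign {1} = - 1" unfolding shuffle_sign_def e1 by simp
    have e2: "{(i, j). i \<in> {0, 1::nat} \<and> j \<notin> {0, 1} \<and> j < i} = {}" by auto
    have s2: "shuffle_sign {0, 1} = 1" unfolding shuffle_sign_def e2 by simp
    have Xg: "X [g] \<in> smooth_S2"
      using that(2) fg by (auto simp: multivector_fields_def smooth_tuples_def)
    have swap: "\<pi> [X [g], f] = - \<pi> [f, X [g]]"
    proof -
      have alt: "\<forall>fs \<in> smooth_tuples 2. \<forall>i<2. \<forall>j<2. i \<noteq> j \<longrightarrow>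
          \<pi> (fs[i := fs ! j, j := fs ! i]) = - \<pi> fs"
        using that(1) unfolding multivector_fields_def by (elim CollectE conjE)
      have "[f, X [g]] \<in> smooth_tuples 2" using fg Xg by (simp add: smooth_tuples_def)
      then have "\<pi> ([f, X [g]][0 := [f, X [g]] ! 1, 1 := [f, X [g]] ! 0]) = - \<pi> [f, X [g]]"
        using alt by (meson one_less_numeral_iff pos2 semiring_norm(76) zero_neq_one)
      then show ?thesis by simp
    qed
    have deg: "2 + 1 - 1 = (2 :: nat)" "1 + 2 - 1 = (2 :: nat)" by simp_all
    have "insertion 2 1 \<pi> X fs x = \<pi> [X [f], g] x + \<pi> [f, X [g]] x" for x
      unfolding insertion_def deg sub fs
      by (subst sum.insert) (simp_all add: s0 s1[simplified] nths_Cons swap)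
    moreover have "insertion 1 2 X \<pi> fs x = X [\<pi> [f, g]] x" for x
      unfolding insertion_def deg sub2 fs by (simp add: s2[simplified] nths_Cons)
    moreover have "(\<Sum>i<2. \<pi> (fs[i := X [fs ! i]])) = \<pi> [X [f], g] + \<pi> [f, X [g]]"
      by (simp add: fs eval_nat_numeral lessThan_Suc)
    ultimately show ?thesis
      using True by (simp add: poisson_diff_def schouten_def lie_derivative_def fs fun_eq_iff)
  qed
qed

end

theory Submission
  imports Defs
begin

text \<open>The obstruction sits on the circle \<open>x\<^sub>3 = c\<close>, along which \<open>\<pi>\<^sub>c\<close> vanishes to first order. With
  \<open>h = c - x\<^sub>3\<close> and cylindrical coordinates \<open>(\<theta>, x\<^sub>3)\<close>, the structure is \<open>h \<partial>\<^sub>\<theta> \<and> \<partial>\<^sub>3\<close>. If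
  \<open>X = a \<partial>\<^sub>3 + b \<partial>\<^sub>\<theta>\<close> satisfies \<open>L\<^sub>X \<pi>\<^sub>c = k \<pi>\<^sub>c\<close>, comparing coefficients gives
  \<open>- a - h (\<partial>\<^sub>3 a + \<partial>\<^sub>\<theta> b) = k h\<close>. On the circle \<open>h = 0\<close> this says \<open>a = 0\<close>; differentiating it across
  the circle, the two terms \<open>\<partial>\<^sub>3 a\<close> cancel and \<open>\<partial>\<^sub>\<theta> b = - k\<close> remains. But \<open>b\<close> is a periodic function
  of \<open>\<theta>\<close>, so \<open>\<partial>\<^sub>\<theta> b\<close> has a zero on the circle, and \<open>k = 0\<close>. The hypothesis \<open>\<bar>c\<bar> < 1\<close> is what
  makes the circle nonempty and keeps it away from the poles, where \<open>\<theta>\<close> is undefined.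

  In order to stay with globally defined functions, \<open>b\<close> is replaced by
  \<open>\<beta> = x\<^sub>1 X(x\<^sub>2) - x\<^sub>2 X(x\<^sub>1) = (x\<^sub>1\<^sup>2 + x\<^sub>2\<^sup>2) b\<close>, and the identity above is extracted from the values of
  \<open>L\<^sub>X \<pi>\<^sub>c\<close> on \<open>(x\<^sub>3, x\<^sub>1)\<close> and \<open>(x\<^sub>3, x\<^sub>2)\<close> (lemma \<open>rescaling_identity\<close>). There \<open>X\<close> is
  applied to polynomials in the coordinates only, so that the derivation rules alone rewrite all of
  its values in terms of \<open>X(x\<^sub>1)\<close>, \<open>X(x\<^sub>2)\<close> and \<open>X(x\<^sub>3)\<close>. Rolle's theorem on the circle finishes the argument (lemma
  \<open>necklace_not_rescaled\<close>). The factor \<open>k = 1\<close> excludes an infinitesimal rescaling, and since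
  \<open>d X = - L\<^sub>X \<pi>\<^sub>c\<close>, the factor \<open>k = - 1\<close> excludes that \<open>\<pi>\<^sub>c\<close> is exact.

  For the class of \<open>\<pi>\<^sub>c\<close> to exist at all, \<open>\<pi>\<^sub>c\<close> must be a smooth biderivation that satisfies the Jacobi
  identity (lemma \<open>necklace_cocycle\<close>). Both are checked in the two charts, where the bracket is
  \<open>\<phi> \<partial>\<^sub>x \<and> \<partial>\<^sub>y\<close> for a smooth \<open>\<phi>\<close>; every such planar bracket satisfies the Jacobi identity because
  second partial derivatives commute.\<close>

section \<open>Calculus of smooth functions\<close>

definition dir_deriv :: "'a::real_normed_vector \<Rightarrow> ('a \<Rightarrow> 'b::real_normed_vector) \<Rightarrow> 'a \<Rightarrow> 'b" where
  "dir_deriv v f x = frechet_derivative f (at x) v"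

lemma dir_deriv_eqI: "(f has_derivative f') (at x) \<Longrightarrow> dir_deriv v f x = f' v"
  unfolding dir_deriv_def by (simp add: frechet_derivative_at[symmetric])

lemma has_derivative_dir_deriv:
  "f differentiable at x \<Longrightarrow> (f has_derivative (\<lambda>v. dir_deriv v f x)) (at x)"
  unfolding dir_deriv_def by (simp add: frechet_derivative_works)

lemma dir_deriv_const [simp]: "dir_deriv v (\<lambda>_. c) x = 0"
  by (simp add: dir_deriv_def)

lemma dir_deriv_linear [simp]: "bounded_linear f \<Longrightarrow> dir_deriv v f x = f v"
  by (rule dir_deriv_eqI) (rule bounded_linear_imp_has_derivative)

lemma dir_deriv_add [simp]:
  assumes "f differentiable at x" and "g differentiable at x"
  shows "dir_deriv v (\<lambda>x. f x + g x) x = dir_deriv v f x + dir_deriv v g x"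
  by (rule dir_deriv_eqI[where f' = "\<lambda>v. dir_deriv v f x + dir_deriv v g x"])
     (intro has_derivative_add has_derivative_dir_deriv assms)

lemma dir_deriv_diff [simp]:
  fixes f g :: "'a::real_normed_vector \<Rightarrow> 'b::real_normed_vector"
  assumes "f differentiable at x" and "g differentiable at x"
  shows "dir_deriv v (\<lambda>x. f x - g x) x = dir_deriv v f x - dir_deriv v g x"
  by (rule dir_deriv_eqI[where f' = "\<lambda>v. dir_deriv v f x - dir_deriv v g x"])
     (intro has_derivative_diff has_derivative_dir_deriv assms)

lemma dir_deriv_mult [simp]:
  fixes f g :: "'a::real_normed_vector \<Rightarrow> real"
  assumes "f differentiable at x" and "g differentiable at x"
  shows "dir_deriv v (\<lambda>x. f x * g x) x = f x * dir_deriv v g x + dir_deriv v f x * g x"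
  by (rule dir_deriv_eqI[where f' = "\<lambda>v. f x * dir_deriv v g x + dir_deriv v f x * g x"])
     (intro has_derivative_mult has_derivative_dir_deriv assms)

lemma dir_deriv_inverse:
  fixes f :: "'a::real_normed_vector \<Rightarrow> real"
  assumes "f differentiable at x" and "f x \<noteq> 0"
  shows "dir_deriv v (\<lambda>x. inverse (f x)) x = - (inverse (f x) * dir_deriv v f x * inverse (f x))"
  by (rule dir_deriv_eqI[where f' = "\<lambda>v. - (inverse (f x) * dir_deriv v f x * inverse (f x))"])
     (intro Deriv.has_derivative_inverse has_derivative_dir_deriv assms)

lemma dir_deriv_lincomb:
  assumes "f differentiable at x"
  shows "dir_deriv (a *\<^sub>R u + b *\<^sub>R v) f x = a *\<^sub>R dir_deriv u f x + b *\<^sub>R dir_deriv v f x"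
proof -
  interpret linear "\<lambda>v. dir_deriv v f x"
    using has_derivative_dir_deriv[OF assms] by (rule has_derivative_linear)
  show ?thesis by (simp add: add scale)
qed

lemma times_differentiable_Suc:
  "times_differentiable (Suc k) f \<longleftrightarrow>
     (\<forall>x. f differentiable at x) \<and> (\<forall>v. times_differentiable k (dir_deriv v f))"
  by (simp add: dir_deriv_def[abs_def])

declare times_differentiable.simps(2) [simp del]

text \<open>The recursion asks for continuity only at level \<open>0\<close>; that the levels are nested, so that lower
  orders of differentiability may be used in inductions, is because differentiable functions are
  continuous.\<close>

lemma times_differentiable_SucD: "times_differentiable (Suc k) f \<Longrightarrow> times_differentiable k f"
proof (induction k arbitrary: f)
  case 0
  then show ?case
    by (auto simp: times_differentiable_Suc intro!: continuous_at_imp_continuous_on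
        differentiable_imp_continuous_within)
next
  case (Suc k)
  then show ?case by (simp add: times_differentiable_Suc[of k] times_differentiable_Suc[of "Suc k"])
qed

lemma smooth_funD:
  assumes "smooth_fun f"
  shows smooth_fun_differentiable [simp]: "f differentiable at x"
    and smooth_fun_dir_deriv: "smooth_fun (dir_deriv v f)"
proof -
  have "times_differentiable (Suc k) f" for k using assms by (simp add: smooth_fun_def)
  then show "f differentiable at x" "smooth_fun (dir_deriv v f)"
    by (simp_all add: times_differentiable_Suc smooth_fun_def)
qed

lemma times_differentiable_const: "times_differentiable k (\<lambda>_. c)"
proof (induction k arbitrary: c)
  case (Suc k)
  have "dir_deriv v (\<lambda>_. c) = (\<lambda>_. 0)" for v :: 'a by (simp add: fun_eq_iff)
  with Suc show ?case by (simp add: times_differentiable_Suc)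
qed simp

lemma times_differentiable_add:
  "times_differentiable k f \<Longrightarrow> times_differentiable k g \<Longrightarrow> times_differentiable k (\<lambda>x. f x + g x)"
proof (induction k arbitrary: f g)
  case (Suc k)
  then have "dir_deriv v (\<lambda>x. f x + g x) = (\<lambda>x. dir_deriv v f x + dir_deriv v g x)" for v
    by (simp add: fun_eq_iff times_differentiable_Suc)
  with Suc show ?case by (simp add: times_differentiable_Suc)
qed (simp add: continuous_on_add)

lemma times_differentiable_mult:
  fixes f g :: "'a::real_normed_vector \<Rightarrow> real"
  shows "times_differentiable k f \<Longrightarrow> times_differentiable k g \<Longrightarrow>
    times_differentiable k (\<lambda>x. f x * g x)"
proof (induction k arbitrary: f g)
  case (Suc k)
  then have "dir_deriv v (\<lambda>x. f x * g x) = (\<lambda>x. f x * dir_deriv v g x + dir_deriv v f x * g x)" for v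
    by (simp add: fun_eq_iff times_differentiable_Suc)
  with Suc show ?case
    using Suc.prems[THEN times_differentiable_SucD]
    by (simp add: times_differentiable_Suc times_differentiable_add)
qed (simp add: continuous_on_mult)

text \<open>The induction closes because the derivative \<open>- f' / f\<^sup>2\<close> of the reciprocal is a product of \<open>f'\<close>
  with two copies of the reciprocal itself, to which the induction hypothesis applies.\<close>

lemma times_differentiable_inverse:
  fixes f :: "'a::real_normed_vector \<Rightarrow> real"
  assumes "\<And>x. f x \<noteq> 0"
  shows "times_differentiable k f \<Longrightarrow> times_differentiable k (\<lambda>x. inverse (f x))"
proof (induction k)
  case 0
  then show ?case using assms by (simp add: continuous_on_inverse)
next
  case (Suc k)
  have inv: "times_differentiable k (\<lambda>x. inverse (f x))"
    using Suc.IH Suc.prems by (blast dest: times_differentiable_SucD)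
  have "dir_deriv v (\<lambda>x. inverse (f x)) =
      (\<lambda>x. - 1 * (inverse (f x) * dir_deriv v f x * inverse (f x)))" for v
    using Suc.prems assms by (simp add: fun_eq_iff times_differentiable_Suc dir_deriv_inverse)
  moreover have "times_differentiable k
      (\<lambda>x. - 1 * (inverse (f x) * dir_deriv v f x * inverse (f x)))" for v
    using Suc.prems
    by (intro times_differentiable_mult times_differentiable_const inv)
       (simp add: times_differentiable_Suc)
  ultimately show ?case
    using Suc.prems assms by (simp add: times_differentiable_Suc)
qed

lemma smooth_fun_const: "smooth_fun (\<lambda>_. c)"
  by (simp add: smooth_fun_def times_differentiable_const)

lemma smooth_fun_linear:
  assumes "bounded_linear f"
  shows "smooth_fun f"
proof -
  have "times_differentiable k f" for k
  proof (cases k)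
    case 0
    then show ?thesis using assms by (simp add: linear_continuous_on)
  next
    case (Suc l)
    have "dir_deriv v f = (\<lambda>_. f v)" for v using assms by (simp add: fun_eq_iff)
    then show ?thesis
      using assms by (simp add: Suc times_differentiable_Suc times_differentiable_const
          bounded_linear_imp_differentiable)
  qed
  then show ?thesis by (simp add: smooth_fun_def)
qed

lemma smooth_fun_add: "smooth_fun f \<Longrightarrow> smooth_fun g \<Longrightarrow> smooth_fun (\<lambda>x. f x + g x)"
  by (simp add: smooth_fun_def times_differentiable_add)

lemma smooth_fun_mult:
  fixes f g :: "'a::real_normed_vector \<Rightarrow> real"
  shows "smooth_fun f \<Longrightarrow> smooth_fun g \<Longrightarrow> smooth_fun (\<lambda>x. f x * g x)"
  by (simp add: smooth_fun_def times_differentiable_mult)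

lemma smooth_fun_minus:
  fixes f :: "'a::real_normed_vector \<Rightarrow> real"
  shows "smooth_fun f \<Longrightarrow> smooth_fun (\<lambda>x. - f x)"
  using smooth_fun_mult[OF smooth_fun_const[of "- 1"]] by simp

lemma smooth_fun_power:
  fixes f :: "'a::real_normed_vector \<Rightarrow> real"
  assumes "smooth_fun f"
  shows "smooth_fun (\<lambda>x. f x ^ n)"
  by (induction n) (simp_all add: smooth_fun_const smooth_fun_mult assms)

lemma smooth_fun_divide:
  fixes f g :: "'a::real_normed_vector \<Rightarrow> real"
  shows "smooth_fun f \<Longrightarrow> smooth_fun g \<Longrightarrow> (\<And>x. g x \<noteq> 0) \<Longrightarrow> smooth_fun (\<lambda>x. f x / g x)"
  unfolding divide_inverse
  by (simp add: smooth_fun_def times_differentiable_inverse times_differentiable_mult)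

lemma smooth_fun_diff:
  fixes f g :: "'a::real_normed_vector \<Rightarrow> real"
  assumes "smooth_fun f" and "smooth_fun g"
  shows "smooth_fun (\<lambda>x. f x - g x)"
  using smooth_fun_add[OF assms(1) smooth_fun_mult[OF smooth_fun_const[of "- 1"] assms(2)]] by simp

lemmas smooth_intros = smooth_fun_const smooth_fun_linear[OF bounded_linear_Re]
  smooth_fun_linear[OF bounded_linear_Im] smooth_fun_add smooth_fun_diff smooth_fun_mult
  smooth_fun_power smooth_fun_divide smooth_fun_dir_deriv

text \<open>The mean value theorem, applied in the direction \<open>u\<close> to the increment of \<open>f\<close> along \<open>v\<close>, and
  then in the direction \<open>v\<close> to the resulting derivative. The left-hand side is symmetric in \<open>u\<close>
  and \<open>v\<close> while the right-hand side a priori is not; the symmetry of second derivatives follows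
  from this.\<close>

lemma second_difference_mean_value:
  fixes f :: "'a::real_normed_vector \<Rightarrow> real"
  assumes "smooth_fun f" and "0 < h"
  obtains s t where "0 < s" "s < h" "0 < t" "t < h"
    "f (x + h *\<^sub>R u + h *\<^sub>R v) - f (x + h *\<^sub>R u) - f (x + h *\<^sub>R v) + f x =
       h\<^sup>2 * dir_deriv v (dir_deriv u f) (x + s *\<^sub>R u + t *\<^sub>R v)"
proof -
  have line: "((\<lambda>s. F (y + s *\<^sub>R w)) has_derivative (\<lambda>t. t * dir_deriv w F (y + s *\<^sub>R w)))
      (at s within S)" if F: "smooth_fun F" for F :: "'a \<Rightarrow> real" and y w s S
  proof -
    have "((\<lambda>s. y + s *\<^sub>R w) has_derivative (\<lambda>t. t *\<^sub>R w)) (at s within S)"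
      by (auto intro!: derivative_eq_intros)
    from has_derivative_compose[OF this has_derivative_dir_deriv[OF smooth_fun_differentiable[OF F]]]
    have "((\<lambda>s. F (y + s *\<^sub>R w)) has_derivative (\<lambda>t. dir_deriv (t *\<^sub>R w) F (y + s *\<^sub>R w)))
        (at s within S)" .
    moreover have "dir_deriv (t *\<^sub>R w) F (y + s *\<^sub>R w) = t * dir_deriv w F (y + s *\<^sub>R w)" for t
      using dir_deriv_lincomb[OF smooth_fun_differentiable[OF F], of t w 0 w] by simp
    ultimately show ?thesis by simp
  qed
  define g where "g s = f ((x + h *\<^sub>R v) + s *\<^sub>R u) - f (x + s *\<^sub>R u)" for s
  have "\<exists>s\<in>{0<..<h}. g h - g 0 =
      (h - 0) * dir_deriv u f ((x + h *\<^sub>R v) + s *\<^sub>R u) - (h - 0) * dir_deriv u f (x + s *\<^sub>R u)"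
    unfolding g_def using assms
    by (intro mvt_simple has_derivative_diff line) auto
  then obtain s where s: "0 < s" "s < h" "g h - g 0 =
      h * (dir_deriv u f ((x + s *\<^sub>R u) + h *\<^sub>R v) - dir_deriv u f ((x + s *\<^sub>R u) + 0 *\<^sub>R v))"
    by (auto simp: algebra_simps)
  have "\<exists>t\<in>{0<..<h}. dir_deriv u f ((x + s *\<^sub>R u) + h *\<^sub>R v) - dir_deriv u f ((x + s *\<^sub>R u) + 0 *\<^sub>R v) =
      (h - 0) * dir_deriv v (dir_deriv u f) ((x + s *\<^sub>R u) + t *\<^sub>R v)"
    using assms by (intro mvt_simple line smooth_fun_dir_deriv) auto
  with s obtain t where "0 < t" "t < h"
    "g h - g 0 = h\<^sup>2 * dir_deriv v (dir_deriv u f) (x + s *\<^sub>R u + t *\<^sub>R v)"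
    by (auto simp: power2_eq_square)
  with s that show thesis by (simp add: g_def algebra_simps)
qed

text \<open>Both mixed derivatives are limits of the same difference quotients: by
  \<open>second_difference_mean_value\<close>, the quotient with step \<open>h\<close> equals either mixed derivative at
  some point that tends to \<open>x\<close> as \<open>h\<close> tends to \<open>0\<close>.\<close>

lemma dir_deriv_commute:
  fixes f :: "'a::real_normed_vector \<Rightarrow> real"
  assumes f: "smooth_fun f"
  shows "dir_deriv v (dir_deriv u f) x = dir_deriv u (dir_deriv v f) x"
proof -
  define h :: "nat \<Rightarrow> real" where "h n = inverse (Suc n)" for n
  define d where "d n = (f (x + h n *\<^sub>R u + h n *\<^sub>R v) - f (x + h n *\<^sub>R u) - f (x + h n *\<^sub>R v) + f x)
     / (h n)\<^sup>2" for n
  have h: "h n > 0" for n by (simp add: h_def)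
  have h0: "h \<longlonglongrightarrow> 0" unfolding h_def by (rule LIMSEQ_inverse_real_of_nat)
  have "d \<longlonglongrightarrow> dir_deriv b (dir_deriv a f) x" if ab: "(a, b) = (u, v) \<or> (a, b) = (v, u)" for a b
  proof -
    have "\<forall>n. \<exists>s t. 0 < s \<and> s < h n \<and> 0 < t \<and> t < h n \<and>
        d n = dir_deriv b (dir_deriv a f) (x + s *\<^sub>R a + t *\<^sub>R b)"
    proof
      fix n
      obtain s t where st: "0 < s" "s < h n" "0 < t" "t < h n"
        and eq: "f (x + h n *\<^sub>R a + h n *\<^sub>R b) - f (x + h n *\<^sub>R a) - f (x + h n *\<^sub>R b) + f x =
          (h n)\<^sup>2 * dir_deriv b (dir_deriv a f) (x + s *\<^sub>R a + t *\<^sub>R b)"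
        by (rule second_difference_mean_value[OF f h])
      have "f (x + h n *\<^sub>R a + h n *\<^sub>R b) - f (x + h n *\<^sub>R a) - f (x + h n *\<^sub>R b) + f x =
          f (x + h n *\<^sub>R u + h n *\<^sub>R v) - f (x + h n *\<^sub>R u) - f (x + h n *\<^sub>R v) + f x"
        using ab by (auto simp: algebra_simps)
      with eq have "f (x + h n *\<^sub>R u + h n *\<^sub>R v) - f (x + h n *\<^sub>R u) - f (x + h n *\<^sub>R v) + f x =
          (h n)\<^sup>2 * dir_deriv b (dir_deriv a f) (x + s *\<^sub>R a + t *\<^sub>R b)"
        by simp
      then have "d n = dir_deriv b (dir_deriv a f) (x + s *\<^sub>R a + t *\<^sub>R b)"
        unfolding d_def by (simp only:) (use h[of n] in simp)
      then show "\<exists>s t. 0 < s \<and> s < h n \<and> 0 < t \<and> t < h n \<and>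
          d n = dir_deriv b (dir_deriv a f) (x + s *\<^sub>R a + t *\<^sub>R b)"
        using st by blast
    qed
    then obtain s t where st: "\<And>n. 0 < s n \<and> s n < h n \<and> 0 < t n \<and> t n < h n"
      and d: "\<And>n. d n = dir_deriv b (dir_deriv a f) (x + s n *\<^sub>R a + t n *\<^sub>R b)"
      by metis
    have "s \<longlonglongrightarrow> 0" "t \<longlonglongrightarrow> 0"
      by (rule tendsto_sandwich[OF _ _ tendsto_const h0];
          use st in \<open>auto intro!: always_eventually less_imp_le\<close>)+
    then have "(\<lambda>n. x + s n *\<^sub>R a + t n *\<^sub>R b) \<longlonglongrightarrow> x + 0 *\<^sub>R a + 0 *\<^sub>R b"
      by (intro tendsto_intros)
    then have lim: "(\<lambda>n. x + s n *\<^sub>R a + t n *\<^sub>R b) \<longlonglongrightarrow> x" by simp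
    have "isCont (dir_deriv b (dir_deriv a f)) x"
      using f by (simp add: differentiable_imp_continuous_within smooth_fun_dir_deriv)
    from isCont_tendsto_compose[OF this lim] have
      "(\<lambda>n. dir_deriv b (dir_deriv a f) (x + s n *\<^sub>R a + t n *\<^sub>R b)) \<longlonglongrightarrow> dir_deriv b (dir_deriv a f) x" .
    moreover have "d = (\<lambda>n. dir_deriv b (dir_deriv a f) (x + s n *\<^sub>R a + t n *\<^sub>R b))"
      using d by (rule ext)
    ultimately show ?thesis by simp
  qed
  then show ?thesis by (metis LIMSEQ_unique)
qed

section \<open>Brackets on the plane\<close>

definition planar_bracket ::
  "(complex \<Rightarrow> real) \<Rightarrow> (complex \<Rightarrow> real) \<Rightarrow> (complex \<Rightarrow> real) \<Rightarrow> complex \<Rightarrow> real" where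
  "planar_bracket \<phi> f g w =
     \<phi> w * (dir_deriv 1 f w * dir_deriv \<i> g w - dir_deriv \<i> f w * dir_deriv 1 g w)"

lemma smooth_planar_bracket:
  "smooth_fun \<phi> \<Longrightarrow> smooth_fun f \<Longrightarrow> smooth_fun g \<Longrightarrow> smooth_fun (planar_bracket \<phi> f g)"
  unfolding planar_bracket_def[abs_def] by (intro smooth_intros)

lemma planar_bracket_antisym: "planar_bracket \<phi> f g w = - planar_bracket \<phi> g f w"
  by (simp add: planar_bracket_def algebra_simps)

lemma planar_bracket_lincomb:
  assumes "smooth_fun f" and "smooth_fun g"
  shows "planar_bracket \<phi> h (\<lambda>w. a * f w + b * g w) w =
    a * planar_bracket \<phi> h f w + b * planar_bracket \<phi> h g w"
  using assms by (simp add: planar_bracket_def smooth_fun_mult smooth_fun_const algebra_simps)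

lemma planar_bracket_Leibniz:
  assumes "smooth_fun f" and "smooth_fun g"
  shows "planar_bracket \<phi> h (\<lambda>w. f w * g w) w =
    f w * planar_bracket \<phi> h g w + g w * planar_bracket \<phi> h f w"
  using assms by (simp add: planar_bracket_def algebra_simps)

text \<open>The first-order terms cancel for antisymmetry reasons, including those with derivatives of \<open>\<phi>\<close>:
  the obstruction is a trivector, and the plane carries no nonzero one. The second-order terms cancel since
  \<open>\<partial>\<^sub>x \<partial>\<^sub>y = \<partial>\<^sub>y \<partial>\<^sub>x\<close>.\<close>

lemma planar_bracket_Jacobi:
  assumes \<phi>: "smooth_fun \<phi>" and f: "smooth_fun f" and g: "smooth_fun g" and h: "smooth_fun h"
  shows "planar_bracket \<phi> (planar_bracket \<phi> f g) h w - planar_bracket \<phi> (planar_bracket \<phi> f h) g w +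
    planar_bracket \<phi> (planar_bracket \<phi> g h) f w = 0"
proof -
  have d: "dir_deriv v (planar_bracket \<phi> a b) w =
      dir_deriv v \<phi> w * (dir_deriv 1 a w * dir_deriv \<i> b w - dir_deriv \<i> a w * dir_deriv 1 b w) +
      \<phi> w * (dir_deriv v (dir_deriv 1 a) w * dir_deriv \<i> b w +
             dir_deriv 1 a w * dir_deriv v (dir_deriv \<i> b) w -
             dir_deriv v (dir_deriv \<i> a) w * dir_deriv 1 b w -
             dir_deriv \<i> a w * dir_deriv v (dir_deriv 1 b) w)"
    if "smooth_fun a" "smooth_fun b" for a b v
    using that \<phi> unfolding planar_bracket_def[abs_def]
    by (simp add: smooth_fun_mult smooth_fun_diff smooth_fun_dir_deriv)
  have c: "dir_deriv \<i> (dir_deriv 1 a) w = dir_deriv 1 (dir_deriv \<i> a) w"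
    if "smooth_fun a" for a :: "complex \<Rightarrow> real"
    using that by (rule dir_deriv_commute)
  show ?thesis
    unfolding planar_bracket_def[of \<phi> "planar_bracket \<phi> _ _"] d[OF f g] d[OF f h] d[OF g h]
      c[OF f] c[OF g] c[OF h]
    by (simp add: algebra_simps)
qed

section \<open>The necklace structures as cocycles\<close>

text \<open>The coefficient of \<open>\<partial>\<^sub>x \<and> \<partial>\<^sub>y\<close> in the expression of \<open>\<pi>\<^sub>c\<close> in the chart \<open>e\<close>. Taking the chart as a
  parameter lets \<open>point_N\<close> and \<open>point_S\<close> be treated by one argument.\<close>

definition necklace_weight :: "real \<Rightarrow> (complex \<Rightarrow> S2) \<Rightarrow> complex \<Rightarrow> real" where
  "necklace_weight c e w = (c - coord 3 (e w)) * (1 / 4 * (1 + (Re w)\<^sup>2 + (Im w)\<^sup>2)\<^sup>2)"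

lemma smooth_S2_point:
  assumes "f \<in> smooth_S2" and "e \<in> {point_N, point_S}"
  shows "smooth_fun (f \<circ> e)"
  using assms by (auto simp: smooth_S2_def)

lemma smooth_S2_I: "(\<And>e. e \<in> {point_N, point_S} \<Longrightarrow> smooth_fun (f \<circ> e)) \<Longrightarrow> f \<in> smooth_S2"
  by (simp add: smooth_S2_def)

lemma coord_smooth: "coord i \<in> smooth_S2"
proof (rule smooth_S2_I)
  fix e assume e: "e \<in> {point_N, point_S}"
  have pos: "1 + ((Re w)\<^sup>2 + (Im w)\<^sup>2) \<noteq> 0" for w
    using denom_pos[of w] by (simp add: cmod_power2)
  consider "i = 1" | "i = 2" | "i = 3" using exhaust_3 by blast
  then show "smooth_fun (coord i \<circ> e)"
    using e by cases (auto simp: comp_def coord_point_N coord_point_S cmod_power2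
        smooth_intros smooth_fun_minus pos)
qed

lemma const_smooth: "(\<lambda>_. a) \<in> smooth_S2"
  by (simp add: smooth_S2_def comp_def smooth_fun_const)

lemma add_smooth: "f \<in> smooth_S2 \<Longrightarrow> g \<in> smooth_S2 \<Longrightarrow> (\<lambda>p. f p + g p) \<in> smooth_S2"
  by (simp add: smooth_S2_def comp_def smooth_fun_add)

lemma mult_smooth: "f \<in> smooth_S2 \<Longrightarrow> g \<in> smooth_S2 \<Longrightarrow> (\<lambda>p. f p * g p) \<in> smooth_S2"
  by (simp add: smooth_S2_def comp_def smooth_fun_mult)

lemma lincomb_smooth:
  "f \<in> smooth_S2 \<Longrightarrow> g \<in> smooth_S2 \<Longrightarrow> (\<lambda>p. a * f p + b * g p) \<in> smooth_S2"
  by (intro add_smooth mult_smooth const_smooth)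

lemma S2_norm: "(coord 1 p)\<^sup>2 + (coord 2 p)\<^sup>2 + (coord 3 p)\<^sup>2 = 1"
  using Rep_S2[of p] by (simp add: coord_def norm_vec_def L2_set_def sum_3)

lemma point_N_stereo_N:
  assumes "coord 3 p \<noteq> - 1"
  shows "point_N (stereo_N p) = p"
proof (rule S2_coords_eqI)
  fix i :: 3
  have z: "1 + coord 3 p \<noteq> 0" using assms by (simp add: add_eq_0_iff)
  have "(cmod (stereo_N p))\<^sup>2 = ((coord 1 p)\<^sup>2 + (coord 2 p)\<^sup>2) / (1 + coord 3 p)\<^sup>2"
    by (simp add: stereo_N_def cmod_power2 power_divide add_divide_distrib)
  also have "(coord 1 p)\<^sup>2 + (coord 2 p)\<^sup>2 = (1 - coord 3 p) * (1 + coord 3 p)"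
    using S2_norm[of p] by (simp add: algebra_simps power2_eq_square)
  finally have n: "(cmod (stereo_N p))\<^sup>2 = (1 - coord 3 p) / (1 + coord 3 p)"
    using z by (simp add: power2_eq_square)
  then have d: "1 + (cmod (stereo_N p))\<^sup>2 = 2 / (1 + coord 3 p)"
    using z by (simp add: field_simps)
  consider "i = 1" | "i = 2" | "i = 3" using exhaust_3 by blast
  then show "coord i (point_N (stereo_N p)) = coord i p"
    using z unfolding stereo_N_def[of p]
    by cases (simp_all add: coord_point_N d[unfolded stereo_N_def] n[unfolded stereo_N_def] field_simps)
qed

text \<open>The south pole is the only point outside the first chart.\<close>

lemma S2_point_cases:
  obtains e w where "e \<in> {point_N, point_S}" and "p = e w"
proof (cases "coord 3 p = - 1")
  case False
  then show ?thesis using that point_N_stereo_N by (metis insertI1)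
next
  case True
  with S2_norm[of p] have z: "coord 1 p = 0" "coord 2 p = 0"
    by (simp_all add: sum_power2_eq_zero_iff)
  have "p = point_S 0"
  proof (rule S2_coords_eqI)
    fix i :: 3
    consider "i = 1" | "i = 2" | "i = 3" using exhaust_3 by blast
    then show "coord i p = coord i (point_S 0)"
      by cases (simp_all add: coord_point_S True z)
  qed
  then show ?thesis using that by blast
qed

lemma S2_fun_eqI:
  assumes "\<And>e w. e \<in> {point_N, point_S} \<Longrightarrow> f (e w) = g (e w)"
  shows "f = g"
proof
  show "f p = g p" for p by (rule S2_point_cases[of p]) (simp add: assms)
qed

text \<open>All properties of the bracket on the sphere are read off from those of planar brackets by means
  of this lemma and \<open>S2_fun_eqI\<close>.\<close>

lemma necklace_in_chart:
  assumes "f \<in> smooth_S2" and "g \<in> smooth_S2" and "e \<in> {point_N, point_S}"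
  shows "necklace c [f, g] \<circ> e = planar_bracket (necklace_weight c e) (f \<circ> e) (g \<circ> e)"
proof -
  have "standard_bracket f g (e w) = chart_bracket (f \<circ> e) (g \<circ> e) w" for w
    using assms by (auto simp: standard_bracket_point_N standard_bracket_point_S)
  then show ?thesis
    using assms(1,2)
    by (simp add: fun_eq_iff necklace_def smooth_tuples_def chart_bracket_def planar_bracket_def
        necklace_weight_def dir_deriv_def)
qed

lemma smooth_necklace_weight:
  assumes "e \<in> {point_N, point_S}"
  shows "smooth_fun (necklace_weight c e)"
proof -
  have "smooth_fun (\<lambda>w. coord 3 (e w))"
    using smooth_S2_point[OF coord_smooth assms, of 3] by (simp add: comp_def)
  then show ?thesis
    unfolding necklace_weight_def[abs_def] by (intro smooth_intros)
qed

lemma necklace_smooth: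
  assumes "f \<in> smooth_S2" and "g \<in> smooth_S2"
  shows "necklace c [f, g] \<in> smooth_S2"
  by (rule smooth_S2_I)
     (simp add: necklace_in_chart[OF assms] smooth_planar_bracket smooth_necklace_weight
        smooth_S2_point[OF assms(1)] smooth_S2_point[OF assms(2)] del: insert_iff)

lemma necklace_antisym:
  assumes "f \<in> smooth_S2" and "g \<in> smooth_S2"
  shows "necklace c [f, g] = - necklace c [g, f]"
proof (rule S2_fun_eqI)
  fix e :: "complex \<Rightarrow> S2" and w assume e: "e \<in> {point_N, point_S}"
  show "necklace c [f, g] (e w) = (- necklace c [g, f]) (e w)"
    using fun_cong[OF necklace_in_chart[OF assms e], of c w]
      fun_cong[OF necklace_in_chart[OF assms(2,1) e], of c w]
      planar_bracket_antisym[of _ "f \<circ> e" "g \<circ> e" w]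
    by simp
qed

lemma necklace_lincomb:
  assumes "h \<in> smooth_S2" and "f \<in> smooth_S2" and "g \<in> smooth_S2"
  shows "necklace c [h, \<lambda>p. a * f p + b * g p] =
    (\<lambda>p. a * necklace c [h, f] p + b * necklace c [h, g] p)"
proof (rule S2_fun_eqI)
  fix e :: "complex \<Rightarrow> S2" and w assume e: "e \<in> {point_N, point_S}"
  show "necklace c [h, \<lambda>p. a * f p + b * g p] (e w) =
      a * necklace c [h, f] (e w) + b * necklace c [h, g] (e w)"
    using fun_cong[OF necklace_in_chart[OF assms(1) lincomb_smooth[OF assms(2,3)] e], of c a b w]
      fun_cong[OF necklace_in_chart[OF assms(1,2) e], of c w]
      fun_cong[OF necklace_in_chart[OF assms(1,3) e], of c w]
      planar_bracket_lincomb[OF smooth_S2_point[OF assms(2) e] smooth_S2_point[OF assms(3) e]]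
    by (simp add: comp_def)
qed

lemma necklace_Leibniz:
  assumes "h \<in> smooth_S2" and "f \<in> smooth_S2" and "g \<in> smooth_S2"
  shows "necklace c [h, f * g] = f * necklace c [h, g] + g * necklace c [h, f]"
proof (rule S2_fun_eqI)
  fix e :: "complex \<Rightarrow> S2" and w assume e: "e \<in> {point_N, point_S}"
  have fg: "f * g \<in> smooth_S2" using mult_smooth[OF assms(2,3)] by (simp add: times_fun_def)
  show "necklace c [h, f * g] (e w) = (f * necklace c [h, g] + g * necklace c [h, f]) (e w)"
    using fun_cong[OF necklace_in_chart[OF assms(1) fg e], of c w]
      fun_cong[OF necklace_in_chart[OF assms(1,2) e], of c w]
      fun_cong[OF necklace_in_chart[OF assms(1,3) e], of c w]
      planar_bracket_Leibniz[OF smooth_S2_point[OF assms(2) e] smooth_S2_point[OF assms(3) e]]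
    by (simp add: comp_def times_fun_def)
qed

lemma smooth_tuples_2E:
  assumes "fs \<in> smooth_tuples 2"
  obtains f g where "fs = [f, g]" "f \<in> smooth_S2" "g \<in> smooth_S2"
  using assms by (auto simp: smooth_tuples_def eval_nat_numeral length_Suc_conv)

lemma necklace_multivector: "necklace c \<in> multivector_fields 2"
proof -
  show ?thesis
    unfolding multivector_fields_def
  proof (intro CollectI conjI allI ballI impI)
    fix fs assume "fs \<notin> smooth_tuples 2"
    then show "necklace c fs = 0" by (simp add: necklace_def zero_fun_def)
  next
    fix fs :: "(S2 \<Rightarrow> real) list" assume "fs \<in> smooth_tuples 2"
    then show "necklace c fs \<in> smooth_S2" by (auto elim!: smooth_tuples_2E intro: necklace_smooth)
  next
    fix fs :: "(S2 \<Rightarrow> real) list" and i :: nat and f g and a b :: real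
    assume "fs \<in> smooth_tuples 2" and i: "i < 2" and fg: "f \<in> smooth_S2" "g \<in> smooth_S2"
    then obtain u v where fs: "fs = [u, v]" and uv: "u \<in> smooth_S2" "v \<in> smooth_S2"
      by (auto elim: smooth_tuples_2E)
    have "necklace c [\<lambda>p. a * f p + b * g p, v] =
        (\<lambda>p. a * necklace c [f, v] p + b * necklace c [g, v] p)"
      using necklace_lincomb[OF uv(2) fg, of c a b] fg uv
      by (simp add: necklace_antisym[of _ v] lincomb_smooth fun_eq_iff)
    moreover have "necklace c [u, \<lambda>p. a * f p + b * g p] =
        (\<lambda>p. a * necklace c [u, f] p + b * necklace c [u, g] p)"
      by (rule necklace_lincomb[OF uv(1) fg])
    ultimately show "necklace c (fs[i := \<lambda>p. a * f p + b * g p]) =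
        (\<lambda>p. a * necklace c (fs[i := f]) p + b * necklace c (fs[i := g]) p)"
      using i by (auto simp: fs less_2_cases_iff)
  next
    fix fs :: "(S2 \<Rightarrow> real) list" and i :: nat and f g
    assume "fs \<in> smooth_tuples 2" and i: "i < 2" and fg: "f \<in> smooth_S2" "g \<in> smooth_S2"
    then obtain u v where fs: "fs = [u, v]" and uv: "u \<in> smooth_S2" "v \<in> smooth_S2"
      by (auto elim: smooth_tuples_2E)
    have m: "f * g \<in> smooth_S2" using mult_smooth[OF fg] by (simp add: times_fun_def)
    have "necklace c [f * g, v] = f * necklace c [g, v] + g * necklace c [f, v]"
      using necklace_Leibniz[OF uv(2) fg, of c] m fg uv
      by (simp add: necklace_antisym[of _ v] fun_eq_iff)
    moreover have "necklace c [u, f * g] = f * necklace c [u, g] + g * necklace c [u, f]"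
      by (rule necklace_Leibniz[OF uv(1) fg])
    ultimately show "necklace c (fs[i := f * g]) =
        f * necklace c (fs[i := g]) + g * necklace c (fs[i := f])"
      using i by (auto simp: fs less_2_cases_iff)
  next
    fix fs :: "(S2 \<Rightarrow> real) list" and i j :: nat
    assume "fs \<in> smooth_tuples 2" and ij: "i < 2" "j < 2" "i \<noteq> j"
    then obtain u v where fs: "fs = [u, v]" and uv: "u \<in> smooth_S2" "v \<in> smooth_S2"
      by (auto elim: smooth_tuples_2E)
    from necklace_antisym[OF uv(2,1)] ij
    show "necklace c (fs[i := fs ! j, j := fs ! i]) = - necklace c fs"
      by (auto simp: fs less_2_cases_iff)
  qed
qed

lemma necklace_Jacobi:
  assumes fgh: "f \<in> smooth_S2" "g \<in> smooth_S2" "h \<in> smooth_S2"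
  shows "necklace c [necklace c [f, g], h] - necklace c [necklace c [f, h], g] +
    necklace c [necklace c [g, h], f] = 0"
proof (rule S2_fun_eqI)
  fix e :: "complex \<Rightarrow> S2" and w assume e: "e \<in> {point_N, point_S}"
  have *: "necklace c [necklace c [a, b], k] (e w) = planar_bracket (necklace_weight c e)
      (planar_bracket (necklace_weight c e) (a \<circ> e) (b \<circ> e)) (k \<circ> e) w"
    if "a \<in> smooth_S2" "b \<in> smooth_S2" "k \<in> smooth_S2" for a b k
    using fun_cong[OF necklace_in_chart[OF necklace_smooth[OF that(1,2)] that(3) e], of c c w]
    unfolding necklace_in_chart[OF that(1,2) e] comp_apply .
  from planar_bracket_Jacobi[OF smooth_necklace_weight[OF e] fgh[THEN smooth_S2_point, OF e]]
  show "(necklace c [necklace c [f, g], h] - necklace c [necklace c [f, h], g] +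
      necklace c [necklace c [g, h], f]) (e w) = 0 (e w)"
    by (simp add: * fgh)
qed

text \<open>The three terms belong to the three shuffles of type \<open>(2, 1)\<close>; the middle one is odd. For \<open>P = Q\<close>
  the sum is the Jacobiator.\<close>

lemma insertion_2_2:
  "insertion 2 2 P Q [f, g, h] x = P [Q [f, g], h] x - P [Q [f, h], g] x + P [Q [g, h], f] x"
proof -
  have deg: "2 + 2 - 1 = (3 :: nat)" by simp
  have "{A :: nat set. A \<subseteq> {..<3} \<and> card A = 2} = {{0, 1}, {0, 2}, {1, 2}}"
  proof (intro equalityI subsetI)
    fix A :: "nat set"
    assume "A \<in> {A. A \<subseteq> {..<3} \<and> card A = 2}"
    then have A: "A \<subseteq> {..<3}" "card A = 2" by simp_all
    then have "card ({..<3} - A) = 1" by (simp add: card_Diff_subset finite_subset[OF A(1)])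
    then obtain k where k: "{..<3} - A = {k}" by (auto simp: card_1_singleton_iff)
    then have eq: "A = {..<3} - {k}" using A(1) by blast
    have three: "{..<3::nat} = {0, 1, 2}" by auto
    have "k < 3" using k by auto
    then consider "k = 0" | "k = 1" | "k = 2" by linarith
    then show "A \<in> {{0, 1}, {0, 2}, {1, 2}}"
      unfolding eq three by cases (simp_all add: insert_Diff_if)
  qed auto
  moreover have "shuffle_sign {0, 1} = 1"
  proof -
    have "{(i, j). i \<in> {0, 1::nat} \<and> j \<notin> {0, 1} \<and> j < i} = {}" by auto
    then show ?thesis by (simp only: shuffle_sign_def) simp
  qed
  moreover have "shuffle_sign {0, 2} = - 1"
  proof -
    have "{(i, j). i \<in> {0, 2::nat} \<and> j \<notin> {0, 2} \<and> j < i} = {(2, 1)}" by auto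
    then show ?thesis by (simp only: shuffle_sign_def) simp
  qed
  moreover have "shuffle_sign {1, 2} = 1"
  proof -
    have "{(i, j). i \<in> {1, 2::nat} \<and> j \<notin> {1, 2} \<and> j < i} = {(1, 0), (2, 0)}" by auto
    then show ?thesis by (simp only: shuffle_sign_def) simp
  qed
  moreover have "{0, 1::nat} \<noteq> {0, 2}" "{0, 1::nat} \<noteq> {1, 2}" "{0, 2::nat} \<noteq> {1, 2}"
    by (simp_all add: doubleton_eq_iff)
  moreover have "nths [f, g, h] {0, 1} = [f, g]" "nths [f, g, h] (- {0, 1}) = [h]"
    "nths [f, g, h] {0, 2} = [f, h]" "nths [f, g, h] (- {0, 2}) = [g]"
    "nths [f, g, h] {1, 2} = [g, h]" "nths [f, g, h] (- {1, 2}) = [f]"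
    by (simp_all add: nths_Cons)
  ultimately show ?thesis
    unfolding insertion_def deg by simp
qed

text \<open>In degree \<open>(2, 2)\<close> the graded commutator is twice the insertion, so \<open>[\<pi>\<^sub>c, \<pi>\<^sub>c]\<close> is twice the
  Jacobiator.\<close>

lemma necklace_cocycle: "necklace c \<in> cocycles (necklace c) 2"
proof -
  have "poisson_diff (necklace c) 2 (necklace c) fs = 0" for fs
  proof (cases "fs \<in> smooth_tuples 3")
    case True
    then have "length fs = Suc (Suc (Suc 0))" and "set fs \<subseteq> smooth_S2"
      by (simp_all add: smooth_tuples_def)
    then obtain f g h where fs: "fs = [f, g, h]"
      and fgh: "f \<in> smooth_S2" "g \<in> smooth_S2" "h \<in> smooth_S2"
      by (auto simp only: length_Suc_conv length_0_conv list.set insert_subset)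
    have "insertion 2 2 (necklace c) (necklace c) fs x = 0" for x
      using fun_cong[OF necklace_Jacobi[OF fgh], of c x] by (simp add: fs insertion_2_2)
    then show ?thesis by (simp add: poisson_diff_def schouten_def zero_fun_def)
  qed (simp add: poisson_diff_def schouten_def)
  then show ?thesis
    by (simp add: cocycles_def necklace_multivector fun_eq_iff)
qed

section \<open>Rotational and radial derivatives\<close>

text \<open>The conformal factor of stereographic projection: the round metric is its square times the flat
  metric. The coordinates of a point of the sphere are \<open>conf_factor w\<close> times polynomials in \<open>w\<close>, up
  to a constant, so that its derivative is the only one that has to be computed.\<close>

definition conf_factor :: "complex \<Rightarrow> real" where
  "conf_factor w = 2 / (1 + (Re w)\<^sup>2 + (Im w)\<^sup>2)"

lemma conf_factor_pos: "conf_factor w > 0"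
  by (simp add: conf_factor_def add_pos_nonneg)

lemma smooth_conf_factor: "smooth_fun conf_factor"
proof -
  have "1 + (Re w)\<^sup>2 + (Im w)\<^sup>2 \<noteq> 0" for w
    using conf_factor_pos[of w] by (auto simp: conf_factor_def)
  then show ?thesis unfolding conf_factor_def[abs_def] by (intro smooth_intros)
qed

lemma dir_deriv_conf_factor:
  "dir_deriv v conf_factor w = - (conf_factor w)\<^sup>2 * (Re w * Re v + Im w * Im v)"
proof -
  have "1 + (Re w)\<^sup>2 + (Im w)\<^sup>2 \<noteq> 0"
    using conf_factor_pos[of w] by (auto simp: conf_factor_def)
  then have "(conf_factor has_derivative
      (\<lambda>v. - (conf_factor w)\<^sup>2 * (Re w * Re v + Im w * Im v))) (at w)"
    unfolding conf_factor_def[abs_def]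
    by (auto intro!: derivative_eq_intros simp: field_simps power2_eq_square)
      (simp add: fun_eq_iff divide_inverse algebra_simps)
  then show ?thesis by (rule dir_deriv_eqI)
qed

lemma coord_conf_factor:
  "coord 1 \<circ> point_N = (\<lambda>w. conf_factor w * Re w)"
  "coord 2 \<circ> point_N = (\<lambda>w. conf_factor w * Im w)"
  "coord 3 \<circ> point_N = (\<lambda>w. conf_factor w - 1)"
  "coord 1 \<circ> point_S = (\<lambda>w. conf_factor w * Re w)"
  "coord 2 \<circ> point_S = (\<lambda>w. - conf_factor w * Im w)"
  "coord 3 \<circ> point_S = (\<lambda>w. 1 - conf_factor w)"
proof -
  have "1 + ((Re w)\<^sup>2 + (Im w)\<^sup>2) \<noteq> 0" for w
    using denom_pos[of w] by (simp add: cmod_power2)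
  then show
    "coord 1 \<circ> point_N = (\<lambda>w. conf_factor w * Re w)"
    "coord 2 \<circ> point_N = (\<lambda>w. conf_factor w * Im w)"
    "coord 3 \<circ> point_N = (\<lambda>w. conf_factor w - 1)"
    "coord 1 \<circ> point_S = (\<lambda>w. conf_factor w * Re w)"
    "coord 2 \<circ> point_S = (\<lambda>w. - conf_factor w * Im w)"
    "coord 3 \<circ> point_S = (\<lambda>w. 1 - conf_factor w)"
    by (simp_all add: fun_eq_iff coord_point_N coord_point_S conf_factor_def cmod_power2 field_simps)
qed

lemma necklace_weight_conf_factor:
  "necklace_weight c e w = (c - coord 3 (e w)) / (conf_factor w)\<^sup>2"
  by (simp add: necklace_weight_def conf_factor_def power_divide)

lemma dir_deriv_Complex:
  fixes f :: "complex \<Rightarrow> real"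
  assumes "f differentiable at w"
  shows "dir_deriv v f w = Re v * dir_deriv 1 f w + Im v * dir_deriv \<i> f w"
proof -
  have "dir_deriv (Re v *\<^sub>R 1 + Im v *\<^sub>R \<i>) f w = Re v * dir_deriv 1 f w + Im v * dir_deriv \<i> f w"
    using dir_deriv_lincomb[OF assms] by simp
  moreover have "Re v *\<^sub>R 1 + Im v *\<^sub>R \<i> = v" by (simp add: complex_eq_iff)
  ultimately show ?thesis by simp
qed

text \<open>Up to normalization these are \<open>\<partial>\<^sub>\<theta>\<close> and \<open>\<partial>\<^sub>3\<close>: the vector \<open>\<i> * w\<close> is tangent to the circle of
  latitude through \<open>w\<close>, and \<open>w\<close> is orthogonal to it.\<close>

definition rot_deriv :: "(complex \<Rightarrow> real) \<Rightarrow> complex \<Rightarrow> real" where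
  "rot_deriv f w = dir_deriv (\<i> * w) f w"

definition rad_deriv :: "(complex \<Rightarrow> real) \<Rightarrow> complex \<Rightarrow> real" where
  "rad_deriv f w = dir_deriv w f w"

lemma rot_deriv_eq:
  "smooth_fun f \<Longrightarrow> rot_deriv f w = Re w * dir_deriv \<i> f w - Im w * dir_deriv 1 f w"
  by (simp add: rot_deriv_def dir_deriv_Complex[of f w "\<i> * w"])

lemma rad_deriv_eq:
  "smooth_fun f \<Longrightarrow> rad_deriv f w = Re w * dir_deriv 1 f w + Im w * dir_deriv \<i> f w"
  by (simp add: rad_deriv_def dir_deriv_Complex[of f w w])

lemma smooth_rot_deriv: "smooth_fun f \<Longrightarrow> smooth_fun (rot_deriv f)"
proof -
  assume f: "smooth_fun f"
  have "smooth_fun (\<lambda>w. Re w * dir_deriv \<i> f w - Im w * dir_deriv 1 f w)"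
    using f by (intro smooth_intros)
  moreover have "rot_deriv f = (\<lambda>w. Re w * dir_deriv \<i> f w - Im w * dir_deriv 1 f w)"
    using f by (simp add: fun_eq_iff rot_deriv_eq)
  ultimately show ?thesis by simp
qed

lemma smooth_rad_deriv: "smooth_fun f \<Longrightarrow> smooth_fun (rad_deriv f)"
proof -
  assume f: "smooth_fun f"
  have "smooth_fun (\<lambda>w. Re w * dir_deriv 1 f w + Im w * dir_deriv \<i> f w)"
    using f by (intro smooth_intros)
  moreover have "rad_deriv f = (\<lambda>w. Re w * dir_deriv 1 f w + Im w * dir_deriv \<i> f w)"
    using f by (simp add: fun_eq_iff rad_deriv_eq)
  ultimately show ?thesis by simp
qed

text \<open>Rolle's theorem for the periodic function \<open>\<theta> \<mapsto> F (r * cis \<theta>)\<close>.\<close>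

lemma rot_deriv_zero_on_circle:
  assumes F: "smooth_fun F"
  obtains \<theta> where "rot_deriv F (of_real r * cis \<theta>) = 0"
proof -
  have der: "((\<lambda>\<theta>. F (of_real r * cis \<theta>)) has_derivative
      (\<lambda>t. t * rot_deriv F (of_real r * cis \<theta>))) (at \<theta>)"
    for \<theta>
  proof -
    define w where "w = of_real r * cis \<theta>"
    have "((\<lambda>\<theta>. of_real r * cis \<theta>) has_derivative (\<lambda>t. of_real r * (t *\<^sub>R (\<i> * cis \<theta>)))) (at \<theta>)"
      by (rule has_derivative_mult_right) (auto intro!: derivative_eq_intros)
    moreover have "(\<lambda>t. of_real r * (t *\<^sub>R (\<i> * cis \<theta>))) = (\<lambda>t. t *\<^sub>R (\<i> * w))"
      by (simp add: w_def fun_eq_iff scaleR_conv_of_real)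
    ultimately have "((\<lambda>\<theta>. of_real r * cis \<theta>) has_derivative (\<lambda>t. t *\<^sub>R (\<i> * w))) (at \<theta>)"
      by simp
    from has_derivative_compose[OF this, of F "\<lambda>v. dir_deriv v F w"]
    have "((\<lambda>\<theta>. F (of_real r * cis \<theta>)) has_derivative (\<lambda>t. dir_deriv (t *\<^sub>R (\<i> * w)) F w)) (at \<theta>)"
      using F has_derivative_dir_deriv[of F w] by (simp add: w_def)
    moreover have "dir_deriv (t *\<^sub>R (\<i> * w)) F w = t * rot_deriv F w" for t
      using dir_deriv_lincomb[of F w t "\<i> * w" 0 0] F by (simp add: rot_deriv_def)
    ultimately show ?thesis by (simp add: w_def)
  qed
  have "\<exists>z. 0 < z \<and> z < 2 * pi \<and> (\<lambda>t. t * rot_deriv F (of_real r * cis z)) = (\<lambda>v. 0)"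
  proof (rule Rolle_deriv)
    show "F (of_real r * cis 0) = F (of_real r * cis (2 * pi))" by simp
    show "continuous_on {0..2 * pi} (\<lambda>\<theta>. F (of_real r * cis \<theta>))"
      using der by (meson has_derivative_at_withinI has_derivative_continuous_on)
  qed (use der in auto)
  then obtain z where "(\<lambda>t. t * rot_deriv F (of_real r * cis z)) = (\<lambda>v. 0)" by blast
  from fun_cong[OF this, of 1] that show thesis by simp
qed

context
  fixes c :: real and g :: "S2 \<Rightarrow> real"
  assumes g: "g \<in> smooth_S2"
begin

text \<open>For the standard structure \<open>x\<^sub>3\<close> generates the rotation about the vertical axis. The sign depends on
  the chart because \<open>w \<mapsto> 1 / w\<close> reverses the sense of rotation.\<close>

lemma necklace_coord3:
  "necklace c [coord 3, g] (point_N w) = - ((c - coord 3 (point_N w)) * rot_deriv (g \<circ> point_N) w)"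
  "necklace c [coord 3, g] (point_S w) = (c - coord 3 (point_S w)) * rot_deriv (g \<circ> point_S) w"
proof -
  have n: "conf_factor w \<noteq> 0" using conf_factor_pos[of w] by simp
  have *: "necklace c [coord 3, g] (e w) = - s * ((c - coord 3 (e w)) * rot_deriv (g \<circ> e) w)"
    if e: "e \<in> {point_N, point_S}"
      and d: "\<And>v. dir_deriv v (coord 3 \<circ> e) w = s * dir_deriv v conf_factor w" for e s
  proof -
    define k where "k = (c - coord 3 (e w)) / (conf_factor w)\<^sup>2"
    define p where "p = dir_deriv 1 (g \<circ> e) w"
    define q where "q = dir_deriv \<i> (g \<circ> e) w"
    have b: "necklace c [coord 3, g] (e w) =
        k * (s * (- (conf_factor w)\<^sup>2 * Re w) * q - s * (- (conf_factor w)\<^sup>2 * Im w) * p)"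
      using fun_cong[OF necklace_in_chart[OF coord_smooth g e, of c 3], of w]
      by (simp add: planar_bracket_def d dir_deriv_conf_factor necklace_weight_conf_factor
          k_def p_def q_def)
    have k: "c - coord 3 (e w) = k * (conf_factor w)\<^sup>2" using n by (simp add: k_def)
    have r: "rot_deriv (g \<circ> e) w = Re w * q - Im w * p"
      using smooth_S2_point[OF g e] by (simp add: rot_deriv_eq p_def q_def)
    show ?thesis unfolding b k r by algebra
  qed
  from *[of point_N 1] *[of point_S "- 1"] show
    "necklace c [coord 3, g] (point_N w) = - ((c - coord 3 (point_N w)) * rot_deriv (g \<circ> point_N) w)"
    "necklace c [coord 3, g] (point_S w) = (c - coord 3 (point_S w)) * rot_deriv (g \<circ> point_S) w"
    using smooth_conf_factor by (simp_all add: coord_conf_factor)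
qed

text \<open>The left-hand side is \<open>(x\<^sub>1\<^sup>2 + x\<^sub>2\<^sup>2) {g, \<theta>}\<close> without reference to the multivalued function \<open>\<theta>\<close>;
  since \<open>\<theta>\<close> is conjugate to \<open>x\<^sub>3\<close>, it is a multiple of the derivative of \<open>g\<close> across the circles of
  latitude.\<close>

lemma necklace_angular:
  "coord 1 (point_N w) * necklace c [g, coord 2] (point_N w) -
   coord 2 (point_N w) * necklace c [g, coord 1] (point_N w) =
     (c - coord 3 (point_N w)) * rad_deriv (g \<circ> point_N) w"
proof -
  have d: "dir_deriv v (\<lambda>w. conf_factor w * Re w) w =
        conf_factor w * Re v + dir_deriv v conf_factor w * Re w"
    "dir_deriv v (\<lambda>w. conf_factor w * Im w) w =
        conf_factor w * Im v + dir_deriv v conf_factor w * Im w" for v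
    using smooth_conf_factor
    by (simp_all add: bounded_linear_Re bounded_linear_Im bounded_linear_imp_differentiable)
  have n: "conf_factor w \<noteq> 0" using conf_factor_pos[of w] by simp
  define k where "k = (c - coord 3 (point_N w)) / (conf_factor w)\<^sup>2"
  define p where "p = dir_deriv 1 (g \<circ> point_N) w"
  define q where "q = dir_deriv \<i> (g \<circ> point_N) w"
  have b: "necklace c [g, coord 1] (point_N w) = k * (p * (- (conf_factor w)\<^sup>2 * Im w * Re w) -
      q * (conf_factor w - (conf_factor w)\<^sup>2 * Re w * Re w))"
    "necklace c [g, coord 2] (point_N w) = k * (p * (conf_factor w - (conf_factor w)\<^sup>2 * Im w * Im w) -
      q * (- (conf_factor w)\<^sup>2 * Re w * Im w))"
    using fun_cong[OF necklace_in_chart[OF g coord_smooth, of point_N c 1], of w]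
      fun_cong[OF necklace_in_chart[OF g coord_smooth, of point_N c 2], of w]
    by (simp_all add: planar_bracket_def coord_conf_factor necklace_weight_conf_factor d
        dir_deriv_conf_factor k_def p_def q_def)
  have x: "coord 1 (point_N w) = conf_factor w * Re w" "coord 2 (point_N w) = conf_factor w * Im w"
    using coord_conf_factor(1,2) by (simp_all add: fun_eq_iff)
  have k: "c - coord 3 (point_N w) = k * (conf_factor w)\<^sup>2" using n by (simp add: k_def)
  have r: "rad_deriv (g \<circ> point_N) w = Re w * p + Im w * q"
    using smooth_S2_point[OF g, of point_N] by (simp add: rad_deriv_eq p_def q_def)
  show ?thesis unfolding b x k r by algebra
qed

end

lemma rot_deriv_coord:
  "rot_deriv (coord 1 \<circ> point_N) w = - coord 2 (point_N w)"
  "rot_deriv (coord 2 \<circ> point_N) w = coord 1 (point_N w)"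
  "rot_deriv (coord 1 \<circ> point_S) w = coord 2 (point_S w)"
  "rot_deriv (coord 2 \<circ> point_S) w = - coord 1 (point_S w)"
proof -
  have "rot_deriv (\<lambda>w. conf_factor w * Re w) w = - (conf_factor w * Im w)"
    "rot_deriv (\<lambda>w. conf_factor w * Im w) w = conf_factor w * Re w"
    "rot_deriv (\<lambda>w. - conf_factor w * Im w) w = - (conf_factor w * Re w)"
    using smooth_conf_factor dir_deriv_mult[of "\<lambda>w. - conf_factor w" w Im "\<i> * w"]
      dir_deriv_diff[of "\<lambda>_. 0" w conf_factor]
    by (simp_all add: rot_deriv_def bounded_linear_Re bounded_linear_Im
        bounded_linear_imp_differentiable dir_deriv_conf_factor)
  moreover have "coord 1 (point_N w) = conf_factor w * Re w" "coord 2 (point_N w) = conf_factor w * Im w"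
    "coord 1 (point_S w) = conf_factor w * Re w" "coord 2 (point_S w) = - conf_factor w * Im w"
    using coord_conf_factor(1,2,4,5) by (simp_all add: fun_eq_iff)
  ultimately show
    "rot_deriv (coord 1 \<circ> point_N) w = - coord 2 (point_N w)"
    "rot_deriv (coord 2 \<circ> point_N) w = coord 1 (point_N w)"
    "rot_deriv (coord 1 \<circ> point_S) w = coord 2 (point_S w)"
    "rot_deriv (coord 2 \<circ> point_S) w = - coord 1 (point_S w)"
    by (simp_all add: coord_conf_factor)
qed

text \<open>The right-hand side is written as a linear combination of products so that linearity and the
  Leibniz rule of a derivation apply to it as it stands. Likewise in \<open>necklace_coord3_coord2\<close>.\<close>

lemma necklace_coord3_coord1:
  "necklace c [coord 3, coord 1] = (\<lambda>p. c * coord 2 p + (- 1) * (coord 3 * coord 2) p)"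
  by (rule S2_fun_eqI) (auto simp: necklace_coord3 coord_smooth rot_deriv_coord algebra_simps)

lemma necklace_coord3_coord2:
  "necklace c [coord 3, coord 2] = (\<lambda>p. (- c) * coord 1 p + 1 * (coord 3 * coord 1) p)"
  by (rule S2_fun_eqI) (auto simp: necklace_coord3 coord_smooth rot_deriv_coord algebra_simps)

section \<open>Vector fields that rescale a necklace structure\<close>

context
  fixes X :: multivector
  assumes X: "X \<in> multivector_fields 1"
begin

lemma vector_field_smooth: "f \<in> smooth_S2 \<Longrightarrow> X [f] \<in> smooth_S2"
  using X by (auto simp: multivector_fields_def smooth_tuples_def)

lemma vector_field_lincomb:
  assumes "f \<in> smooth_S2" and "g \<in> smooth_S2"
  shows "X [\<lambda>p. a * f p + b * g p] = (\<lambda>p. a * X [f] p + b * X [g] p)"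
proof -
  have "\<forall>fs \<in> smooth_tuples 1. \<forall>i<1. \<forall>f \<in> smooth_S2. \<forall>g \<in> smooth_S2. \<forall>a b :: real.
      X (fs[i := (\<lambda>p. a * f p + b * g p)]) = (\<lambda>p. a * X (fs[i := f]) p + b * X (fs[i := g]) p)"
    using X unfolding multivector_fields_def by (elim CollectE conjE)
  moreover have "[f] \<in> smooth_tuples 1" using assms by (simp add: smooth_tuples_def)
  ultimately show ?thesis using assms by fastforce
qed

lemma vector_field_Leibniz:
  assumes "f \<in> smooth_S2" and "g \<in> smooth_S2"
  shows "X [f * g] = f * X [g] + g * X [f]"
proof -
  have "\<forall>fs \<in> smooth_tuples 1. \<forall>i<1. \<forall>f \<in> smooth_S2. \<forall>g \<in> smooth_S2.
      X (fs[i := f * g]) = f * X (fs[i := g]) + g * X (fs[i := f])"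
    using X unfolding multivector_fields_def by (elim CollectE conjE)
  moreover have "[f] \<in> smooth_tuples 1" using assms by (simp add: smooth_tuples_def)
  ultimately show ?thesis using assms by fastforce
qed

end

lemma lie_derivative_bracket:
  assumes "f \<in> smooth_S2" and "g \<in> smooth_S2"
  shows "lie_derivative 2 X P [f, g] = X [P [f, g]] - P [X [f], g] - P [f, X [g]]"
  using assms by (simp add: lie_derivative_def smooth_tuples_def eval_nat_numeral lessThan_Suc
      fun_eq_iff)

text \<open>This is \<open>- a - h (\<partial>\<^sub>3 a + \<partial>\<^sub>\<theta> b) = k h\<close> multiplied by \<open>x\<^sub>1\<^sup>2 + x\<^sub>2\<^sup>2\<close>, with \<open>a = X(x\<^sub>3)\<close> and \<open>b\<close>
  replaced by \<open>\<beta>\<close>. It is the combination of the rescaling equations for \<open>(x\<^sub>3, x\<^sub>1)\<close> and \<open>(x\<^sub>3, x\<^sub>2)\<close> with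
  coefficients \<open>x\<^sub>2\<close> and \<open>- x\<^sub>1\<close>, which stands in for the equation for the pair \<open>(x\<^sub>3, \<theta>)\<close>.\<close>

lemma rescaling_identity:
  assumes X: "X \<in> multivector_fields 1"
    and L: "\<And>f g. f \<in> smooth_S2 \<Longrightarrow> g \<in> smooth_S2 \<Longrightarrow>
      lie_derivative 2 X (necklace c) [f, g] = (\<lambda>p. k * necklace c [f, g] p)"
  defines "\<beta> \<equiv> \<lambda>p. coord 1 p * X [coord 2] p - coord 2 p * X [coord 1] p"
  shows "(c - coord 3 (point_N w)) * (rad_deriv (X [coord 3] \<circ> point_N) w - rot_deriv (\<beta> \<circ> point_N) w -
      k * ((coord 1 (point_N w))\<^sup>2 + (coord 2 (point_N w))\<^sup>2)) =
    ((coord 1 (point_N w))\<^sup>2 + (coord 2 (point_N w))\<^sup>2) * X [coord 3] (point_N w)"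
proof -
  define p where "p = point_N w"
  note sm = vector_field_smooth[OF X coord_smooth]
  have m: "coord 3 * coord i \<in> smooth_S2" for i
    using mult_smooth[OF coord_smooth[of 3] coord_smooth[of i]] by (simp add: times_fun_def)
  have lie: "X [necklace c [coord 3, coord i]] p - necklace c [X [coord 3], coord i] p -
      necklace c [coord 3, X [coord i]] p = k * necklace c [coord 3, coord i] p" for i
    using fun_cong[OF L[OF coord_smooth coord_smooth, of 3 i], of p]
    by (simp add: lie_derivative_bracket coord_smooth)
  have X1: "X [necklace c [coord 3, coord 1]] p =
      (c - coord 3 p) * X [coord 2] p - coord 2 p * X [coord 3] p"
    unfolding necklace_coord3_coord1 vector_field_lincomb[OF X coord_smooth m]
      vector_field_Leibniz[OF X coord_smooth coord_smooth]
    by (simp add: algebra_simps)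
  have X2: "X [necklace c [coord 3, coord 2]] p =
      - (c - coord 3 p) * X [coord 1] p + coord 1 p * X [coord 3] p"
    unfolding necklace_coord3_coord2 vector_field_lincomb[OF X coord_smooth m]
      vector_field_Leibniz[OF X coord_smooth coord_smooth]
    by (simp add: algebra_simps)
  have P1: "necklace c [coord 3, coord 1] p = (c - coord 3 p) * coord 2 p"
    "necklace c [coord 3, coord 2] p = - (c - coord 3 p) * coord 1 p"
    by (simp_all add: necklace_coord3_coord1 necklace_coord3_coord2 algebra_simps)
  have P3: "necklace c [coord 3, X [coord i]] p =
      - ((c - coord 3 p) * rot_deriv (X [coord i] \<circ> point_N) w)" for i
    unfolding p_def by (rule necklace_coord3(1)[OF sm])
  have rotx: "rot_deriv (coord 1 \<circ> point_N) w = - coord 2 p"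
    "rot_deriv (coord 2 \<circ> point_N) w = coord 1 p"
    by (simp_all add: rot_deriv_coord p_def)
  \<comment> \<open>The terms \<open>x\<^sub>1 X(x\<^sub>1) + x\<^sub>2 X(x\<^sub>2)\<close> produced here by rotating the factors \<open>x\<^sub>1\<close> and \<open>x\<^sub>2\<close> of \<open>\<beta>\<close> are
    those that \<open>X1\<close> and \<open>X2\<close> contribute to the combination.\<close>
  have "rot_deriv (\<beta> \<circ> point_N) w = coord 1 p * rot_deriv (X [coord 2] \<circ> point_N) w -
      coord 1 p * X [coord 1] p - coord 2 p * rot_deriv (X [coord 1] \<circ> point_N) w - coord 2 p * X [coord 2] p"
  proof -
    have "\<beta> \<circ> point_N = (\<lambda>w. (coord 1 \<circ> point_N) w * (X [coord 2] \<circ> point_N) w -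
        (coord 2 \<circ> point_N) w * (X [coord 1] \<circ> point_N) w)"
      by (simp add: \<beta>_def fun_eq_iff)
    moreover have "(coord i \<circ> point_N) differentiable at w"
      "(X [coord i] \<circ> point_N) differentiable at w" for i
      using smooth_S2_point[OF coord_smooth] smooth_S2_point[OF sm] by simp_all
    ultimately show ?thesis
      using rotx by (simp add: rot_deriv_def p_def algebra_simps del: comp_apply) (simp add: p_def)
  qed
  moreover have "coord 1 p * necklace c [X [coord 3], coord 2] p -
      coord 2 p * necklace c [X [coord 3], coord 1] p =
      (c - coord 3 p) * rad_deriv (X [coord 3] \<circ> point_N) w"
    unfolding p_def by (rule necklace_angular[OF sm])
  ultimately show ?thesis
    using lie[of 1] lie[of 2] unfolding X1 X2 P1 P3 p_def[symmetric]
    by algebra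
qed

text \<open>Write \<open>H * K = R * e\<close> for the identity of \<open>rescaling_identity\<close> in the chart. Where \<open>H = 0\<close>, it gives
  \<open>e = 0\<close>, and its radial derivative gives \<open>K = rad_deriv e\<close> because \<open>H\<close> and the squared distance
  \<open>R\<close> from the axis satisfy \<open>rad_deriv H = R\<close>. What is left is \<open>rot_deriv b = - k R\<close>, which never
  vanishes on the circle, against \<open>rot_deriv_zero_on_circle\<close>. The case \<open>k = 0\<close> is a
  true exception: every Hamiltonian vector field preserves its Poisson structure.\<close>

lemma necklace_not_rescaled:
  assumes c: "\<bar>c\<bar> < 1" and X: "X \<in> multivector_fields 1" and k: "k \<noteq> 0"
    and L: "\<And>f g. f \<in> smooth_S2 \<Longrightarrow> g \<in> smooth_S2 \<Longrightarrow>
      lie_derivative 2 X (necklace c) [f, g] = (\<lambda>p. k * necklace c [f, g] p)"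
  shows False
proof -
  define e where "e = X [coord 3] \<circ> point_N"
  define \<beta> where "\<beta> = (\<lambda>p. coord 1 p * X [coord 2] p - coord 2 p * X [coord 1] p)"
  define b where "b = \<beta> \<circ> point_N"
  define H where "H w = c - (conf_factor w - 1)" for w
  define R where "R w = (conf_factor w)\<^sup>2 * ((Re w)\<^sup>2 + (Im w)\<^sup>2)" for w
  note sm = vector_field_smooth[OF X coord_smooth]
  have e: "smooth_fun e" unfolding e_def by (rule smooth_S2_point[OF sm]) simp
  have "\<beta> = (\<lambda>p. 1 * (coord 1 p * X [coord 2] p) + (- 1) * (coord 2 p * X [coord 1] p))"
    by (simp add: \<beta>_def)
  also have "\<dots> \<in> smooth_S2" by (intro lincomb_smooth mult_smooth coord_smooth sm)
  finally have b: "smooth_fun b" unfolding b_def by (rule smooth_S2_point) simp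
  have H: "smooth_fun H" and R: "smooth_fun R"
    unfolding H_def[abs_def] R_def[abs_def] by (intro smooth_intros smooth_conf_factor)+
  have x: "coord 1 (point_N w) = conf_factor w * Re w" "coord 2 (point_N w) = conf_factor w * Im w"
    "coord 3 (point_N w) = conf_factor w - 1" for w
    using coord_conf_factor(1-3) by (simp_all add: fun_eq_iff)
  define K where "K w = rad_deriv e w - rot_deriv b w - k * R w" for w
  have K: "smooth_fun K"
    unfolding K_def[abs_def] by (intro smooth_intros smooth_rad_deriv smooth_rot_deriv e b R)
  have id: "H w * K w = R w * e w" for w
    using rescaling_identity[OF X L, of w]
    by (simp add: H_def R_def K_def x e_def b_def \<beta>_def power_mult_distrib distrib_left)
  \<comment> \<open>The radius of the circle \<open>x\<^sub>3 = c\<close> in the chart, i.e. the zero set of \<open>H\<close>.\<close>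
  define r where "r = sqrt ((1 - c) / (1 + c))"
  obtain \<theta> where \<theta>: "rot_deriv b (of_real r * cis \<theta>) = 0"
    by (rule rot_deriv_zero_on_circle[OF b])
  define w where "w = of_real r * cis \<theta>"
  have r2: "(Re w)\<^sup>2 + (Im w)\<^sup>2 = (1 - c) / (1 + c)"
  proof -
    have "(Re w)\<^sup>2 + (Im w)\<^sup>2 = r\<^sup>2 * ((cos \<theta>)\<^sup>2 + (sin \<theta>)\<^sup>2)"
      unfolding w_def by (simp add: power_mult_distrib flip: distrib_left)
    then show ?thesis using c by (simp add: r_def)
  qed
  have "conf_factor w = 1 + c"
    unfolding conf_factor_def add.assoc r2 using c by (simp add: field_simps)
  then have H0: "H w = 0" by (simp add: H_def)
  have R0: "R w > 0"
    unfolding R_def r2 using c conf_factor_pos[of w] by simp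
  with id[of w] H0 have e0: "e w = 0" by simp
  \<comment> \<open>As \<open>H\<close> and \<open>e\<close> vanish at \<open>w\<close>, only one term survives on either side of the
    differentiated identity.\<close>
  have "rad_deriv (\<lambda>w. H w * K w) w = rad_deriv (\<lambda>w. R w * e w) w" by (simp add: id)
  then have "rad_deriv H w * K w = R w * rad_deriv e w"
    using H K R e by (simp add: rad_deriv_def H0 e0)
  moreover have "rad_deriv H w = R w"
    using smooth_conf_factor unfolding H_def[abs_def]
    by (simp add: rad_deriv_def dir_deriv_conf_factor R_def power2_eq_square)
  ultimately have "K w = rad_deriv e w" using R0 by simp
  then have "k * R w = 0" using \<theta> by (simp add: K_def w_def)
  with k R0 show False by simp
qed

theorem corollary4p3p3:
  fixes c :: real
  assumes "\<bar>c\<bar> < 1"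
  shows "cohomology_class (necklace c) 2 (necklace c) \<in> poisson_cohomology (necklace c) 2 \<and>
    cohomology_class (necklace c) 2 (necklace c) \<noteq> cohomology_class (necklace c) 2 0 \<and>
    \<not> (\<exists>X \<in> multivector_fields 1. lie_derivative 2 X (necklace c) = necklace c)"
proof (intro conjI notI)
  show "cohomology_class (necklace c) 2 (necklace c) \<in> poisson_cohomology (necklace c) 2"
    unfolding cohomology_class_def poisson_cohomology_def
    by (rule quotientI) (rule necklace_cocycle)
next
  assume "\<exists>X \<in> multivector_fields 1. lie_derivative 2 X (necklace c) = necklace c"
  then obtain X where X: "X \<in> multivector_fields 1"
    and L: "lie_derivative 2 X (necklace c) = necklace c" by blast
  show False
    by (rule necklace_not_rescaled[OF assms X, of 1]) (simp_all add: L)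
next
  \<comment> \<open>Equality of the classes yields \<open>\<pi>\<^sub>c - 0 \<in> coboundaries\<close> once \<open>\<pi>\<^sub>c\<close> lies in its own class, for
    which \<open>0\<close> has to be a coboundary.\<close>
  assume "cohomology_class (necklace c) 2 (necklace c) = cohomology_class (necklace c) 2 0"
  moreover have "necklace c \<in> cohomology_class (necklace c) 2 (necklace c)"
  proof -
    have zero: "0 \<in> multivector_fields 1"
      by (simp add: multivector_fields_def zero_fun_def const_smooth fun_eq_iff)
    have "necklace c [h, 0] = 0" if "h \<in> smooth_S2" for h
      using necklace_lincomb[OF that const_smooth[of 0] const_smooth[of 0], of c 0 0]
      by (simp add: zero_fun_def)
    moreover from this have "necklace c [0, h] = 0" if "h \<in> smooth_S2" for h
      using necklace_antisym[of 0 h c] that const_smooth[of 0] by (simp add: zero_fun_def)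
    ultimately have "lie_derivative 2 0 (necklace c) [f, g] = 0"
      if "f \<in> smooth_S2" "g \<in> smooth_S2" for f g
      using that by (simp add: lie_derivative_bracket)
    moreover have "lie_derivative 2 0 (necklace c) fs = 0" if "fs \<notin> smooth_tuples 2" for fs
      using that by (simp add: lie_derivative_def)
    ultimately have "lie_derivative 2 0 (necklace c) fs = 0" for fs
      by (metis smooth_tuples_2E)
    then have "poisson_diff (necklace c) 1 0 = 0"
      unfolding poisson_diff_vector_field[OF necklace_multivector zero] by (simp add: fun_eq_iff)
    with zero have "0 \<in> poisson_diff (necklace c) 1 ` multivector_fields 1" by force
    then have "0 \<in> coboundaries (necklace c) 2"
      by (simp add: coboundaries_def numeral_2_eq_2)
    then show ?thesis by (simp add: cohomology_class_def cohomologous_def necklace_cocycle)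
  qed
  ultimately have "necklace c - 0 \<in> coboundaries (necklace c) 2"
    by (simp add: cohomology_class_def cohomologous_def)
  then obtain X where X: "X \<in> multivector_fields 1"
    and "necklace c = poisson_diff (necklace c) 1 X"
    by (auto simp: coboundaries_def numeral_2_eq_2)
  then have "necklace c = - lie_derivative 2 X (necklace c)"
    by (simp only: poisson_diff_vector_field[OF necklace_multivector X])
  then have "lie_derivative 2 X (necklace c) = - necklace c"
    by (metis minus_minus)
  then show False
    by (intro necklace_not_rescaled[OF assms X, of "- 1"]) (simp_all add: fun_eq_iff)
qed

end
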